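(* Let $\rho>0$ be a fixed constant and let $\mathcal{P}$ be a distribution over truthful-auction requests $(v,x,p)$ such that $$\beta:=\mathbb{E}_{(v,x,p)\sim\mathcal{P}}\left[\max\left(0,\,v\cdot x(v)-p(v)\right)\right]$$ is an absolute constant bounded away from $0$ and independent of $T$. With i.i.d. inputs $\gamma_1,\dots,\gamma_T$ from $\mathcal{P}$ over a time horizon $T$, the regret of the two-phase bidding algorithm (Algorithm S, defined in the context) on the bidding problem with both return-on-spend and budget constraints (defined in the context) is bounded by $$\mathrm{Regret}(\text{Algorithm S},\mathcal{P}^T)\le O(\sqrt{T}\log T).$$ Further, Algorithm S suffers no violation of either the return-on-spend or the budget constraint: its bids $b_1,\dots,b_T$ satisfy $$\sum_{t=1}^T p_t(b_t)\le\sum_{t=1}^T v_t\cdot x_t(b_t)\qquad\text{and}\qquad \sum_{t=1}^T p_t(b_t)\le\rho T .$$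
   Context: Requests. A request is a tuple $\gamma=(v,x,p)$ with value $v\in[0,1]$, non-decreasing allocation function $x:\mathbb{R}_{\ge 0}\to[0,1]$, and payment function $p:\mathbb{R}_{\ge 0}\to[0,1]$ satisfying $p(b)=b\,x(b)-\int_0^b x(z)\,dz$ (truthful auction). Over $T$ rounds requests $\gamma_t=(v_t,x_t,p_t)$ arrive i.i.d. from $\mathcal{P}$. In round $t$ the bidder sees $v_t$, chooses a bid $b_t\ge 0$, then observes $x_t(b_t)$ and $p_t(b_t)$. Put $g_t(b)=v_t\,x_t(b)-p_t(b)$. Problem. Maximize $\sum_{t=1}^T v_t x_t(b_t)$ over bids $b_t\ge0$ subject to the return-on-spend (RoS) constraint $\sum_{t=1}^T p_t(b_t)\le\sum_{t=1}^T v_t x_t(b_t)$ and the budget constraint $\sum_{t=1}^T p_t(b_t)\le\rho T$. For a request sequence $\vec\gamma$, $\mathrm{Reward}(\mathrm{Opt},\vec\gamma)$ is the optimal value of this problem, in hindsight. For an algorithm Alg producing bids $b_t$, $\mathrm{Reward}(\mathrm{Alg},\vec\gamma)=\sum_{t=1}^T v_t x_t(b_t)$, and $\mathrm{Regret}(\mathrm{Alg},\mathcal{P}^T)=\mathbb{E}_{\vec\gamma\sim\mathcal{P}^T}[\mathrm{Reward}(\mathrm{Opt},\vec\gamma)-\mathrm{Reward}(\mathrm{Alg},\vec\gamma)]$. The $O(\cdot)$ treats $\rho$ and $\beta$ as constants. Algorithm A (horizon $n$, total budget $\rho' n$, requests indexed $1,\dots,n$). Set $\lambda_1=1$, $\mu_1=0$,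 $B_1=\rho' n$, $\alpha=1/\sqrt n$, $\eta=1/((1+\rho'^2)\sqrt n)$. For $t=1,\dots,n$: bid $b_t=\frac{1+\lambda_t}{\mu_t+\lambda_t}v_t$ if $B_t\ge1$ and $b_t=0$ otherwise; set $\lambda_{t+1}=\lambda_t\exp(-\alpha g_t(b_t))$, $\mu_{t+1}=\max(0,\mu_t-\eta(\rho'-p_t(b_t)))$, $B_{t+1}=B_t-p_t(b_t)$. Algorithm S (horizon $T$, total budget $\rho T$). Set $B_1=\rho T$, $t=1$. First phase: while $\sum_{i=1}^{t-1}g_i(b_i)\le 2\sqrt T\log T$ (and requests remain): bid $b_t=v_t$, set $B_{t+1}=B_t-p_t(b_t)$, increment $t$ by one, and if now $t\ge\rho T$ then exit the algorithm (no further bidding, i.e. bid $0$ in all remaining rounds). Second phase: if the first phase ended without exiting, after $K$ rounds, run Algorithm A afresh on the remaining $T-K$ requests $\gamma_{K+1},\dots,\gamma_T$ with horizon $n=T-K$ and total initial budget $B_{K+1}$ (so $\rho'=B_{K+1}/(T-K)$).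
   Formalization: The budget claim is proved for ρT ≥ 1 only: if ρT < 1 it can fail, as round 1 is always bid v_1 and may cost 1 > ρT. The regret bound is stated for T ≥ 2 (log 1 = 0), with requests measurable so that expectations make sense. *)

theory Defs
  imports "HOL-Probability.Probability" "HOL-Library.While_Combinator"
begin

text \<open>A request (v, x, p): value, allocation function and payment function. Bids range over
  the nonnegative reals; the values of x and p at negative arguments are never used.\<close>

type_synonym request = "real \<times> (real \<Rightarrow> real) \<times> (real \<Rightarrow> real)"

definition valuation :: "request \<Rightarrow> real" where
  "valuation q = fst q"

definition alloc :: "request \<Rightarrow> real \<Rightarrow> real" where
  "alloc q = fst (snd q)"

definition pay :: "request \<Rightarrow> real \<Rightarrow> real" where
  "pay q = snd (snd q)"

definition gain :: "request \<Rightarrow> real \<Rightarrow> real" where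
  "gain q b = valuation q * alloc q b - pay q b"

definition truthful_requests :: "request set" where
  "truthful_requests = {q.
     0 \<le> valuation q \<and> valuation q \<le> 1 \<and>
     mono_on {0..} (alloc q) \<and>
     (\<forall>b\<ge>0. 0 \<le> alloc q b \<and> alloc q b \<le> 1 \<and>
            0 \<le> pay q b \<and> pay q b \<le> 1 \<and>
            pay q b = b * alloc q b - integral {0..b} (alloc q))}"

text \<open>The sigma-algebra on requests is that of P. It has to make the value measurable, and the
  allocation x(b) measurable jointly in the bid b and the request, so that the outcome at a random
  bid is a random variable; for the payment p(b) this follows from the payment formula.\<close>

definition request_distribution :: "request measure \<Rightarrow> bool" where
  "request_distribution P \<longleftrightarrow>
     prob_space P \<and> space P \<subseteq> truthful_requests \<and>
     valuation \<in> borel_measurable P \<and>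
     (\<lambda>(b, q). alloc q b) \<in> borel_measurable (restrict_space borel {0..} \<Otimes>\<^sub>M P)"

definition expected_truthful_gain :: "request measure \<Rightarrow> real" where
  "expected_truthful_gain P = (LINT q|P. max 0 (gain q (valuation q)))"


section \<open>The bidding problem\<close>

text \<open>Sequences of requests and of bids are indexed by the rounds 1, ..., T.\<close>

definition reward :: "nat \<Rightarrow> (nat \<Rightarrow> request) \<Rightarrow> (nat \<Rightarrow> real) \<Rightarrow> real" where
  "reward T \<gamma> b = (\<Sum>t=1..T. valuation (\<gamma> t) * alloc (\<gamma> t) (b t))"

definition spend :: "nat \<Rightarrow> (nat \<Rightarrow> request) \<Rightarrow> (nat \<Rightarrow> real) \<Rightarrow> real" where
  "spend T \<gamma> b = (\<Sum>t=1..T. pay (\<gamma> t) (b t))"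

definition satisfies_RoS :: "nat \<Rightarrow> (nat \<Rightarrow> request) \<Rightarrow> (nat \<Rightarrow> real) \<Rightarrow> bool" where
  "satisfies_RoS T \<gamma> b \<longleftrightarrow> spend T \<gamma> b \<le> reward T \<gamma> b"

definition satisfies_budget :: "real \<Rightarrow> nat \<Rightarrow> (nat \<Rightarrow> request) \<Rightarrow> (nat \<Rightarrow> real) \<Rightarrow> bool" where
  "satisfies_budget \<rho> T \<gamma> b \<longleftrightarrow> spend T \<gamma> b \<le> \<rho> * real T"

definition feasible_bids :: "real \<Rightarrow> nat \<Rightarrow> (nat \<Rightarrow> request) \<Rightarrow> (nat \<Rightarrow> real) set" where
  "feasible_bids \<rho> T \<gamma> =
     {b. (\<forall>t\<in>{1..T}. 0 \<le> b t) \<and> satisfies_RoS T \<gamma> b \<and> satisfies_budget \<rho> T \<gamma> b}"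

text \<open>A supremum, since the allocation functions need not be semicontinuous and an optimal bid
  vector need not exist.\<close>

definition opt_reward :: "real \<Rightarrow> nat \<Rightarrow> (nat \<Rightarrow> request) \<Rightarrow> real" where
  "opt_reward \<rho> T \<gamma> = (SUP b\<in>feasible_bids \<rho> T \<gamma>. reward T \<gamma> b)"

definition iid_requests :: "nat \<Rightarrow> request measure \<Rightarrow> (nat \<Rightarrow> request) measure" where
  "iid_requests T P = (\<Pi>\<^sub>M t\<in>{1..T}. P)"

text \<open>The expectation is over the completion of the product measure: the hindsight optimum is a
  supremum over an uncountable set of bid vectors, so its superlevel sets are projections of
  measurable sets. By the measurable projection theorem these belong to the completed
  sigma-algebra, though not necessarily to the product sigma-algebra itself. The optimum, being
  bounded by 0 and T, is thus integrable with respect to the completion.\<close>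

definition regret ::
  "real \<Rightarrow> nat \<Rightarrow> request measure \<Rightarrow> ((nat \<Rightarrow> request) \<Rightarrow> nat \<Rightarrow> real) \<Rightarrow> real" where
  "regret \<rho> T P alg =
     (LINT \<gamma>|completion (iid_requests T P). opt_reward \<rho> T \<gamma> - reward T \<gamma> (alg \<gamma>))"


section \<open>Algorithm A\<close>

text \<open>A state consists of the dual variables \<open>\<lambda>\<close> (called l) and \<open>\<mu>\<close> (called m) and the
  remaining budget B. The state after k rounds is the state in which round k + 1 is bid.\<close>

type_synonym A_state = "real \<times> real \<times> real"

fun A_bid_in :: "A_state \<Rightarrow> real \<Rightarrow> real" where
  "A_bid_in (l, m, B) v = (if B \<ge> 1 then (1 + l) / (m + l) * v else 0)"

fun A_update :: "nat \<Rightarrow> real \<Rightarrow> request \<Rightarrow> A_state \<Rightarrow> A_state" where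
  "A_update n r q (l, m, B) =
     (let b = A_bid_in (l, m, B) (valuation q);
          \<alpha> = 1 / sqrt (real n);
          \<eta> = 1 / ((1 + r\<^sup>2) * sqrt (real n))
      in (l * exp (- \<alpha> * gain q b), max 0 (m - \<eta> * (r - pay q b)), B - pay q b))"

primrec A_state_after :: "nat \<Rightarrow> real \<Rightarrow> (nat \<Rightarrow> request) \<Rightarrow> nat \<Rightarrow> A_state" where
  "A_state_after n r \<gamma> 0 = (1, 0, r * real n)"
| "A_state_after n r \<gamma> (Suc k) = A_update n r (\<gamma> (Suc k)) (A_state_after n r \<gamma> k)"

definition A_bids :: "nat \<Rightarrow> real \<Rightarrow> (nat \<Rightarrow> request) \<Rightarrow> nat \<Rightarrow> real" where
  "A_bids n r \<gamma> t = A_bid_in (A_state_after n r \<gamma> (t - 1)) (valuation (\<gamma> t))"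


section \<open>Algorithm S\<close>

text \<open>The loop state is (t, B, G, e): the current round t, the remaining budget B, the accumulated
  gain G of the rounds before t, and whether the algorithm has been exited. The loop runs for at
  most T iterations.\<close>

definition S_first_phase :: "real \<Rightarrow> nat \<Rightarrow> (nat \<Rightarrow> request) \<Rightarrow> nat \<times> real \<times> real \<times> bool" where
  "S_first_phase \<rho> T \<gamma> =
     while (\<lambda>(t, B, G, e). \<not> e \<and> t \<le> T \<and> G \<le> 2 * sqrt (real T) * ln (real T))
       (\<lambda>(t, B, G, e).
          let q = \<gamma> t; b = valuation q
          in (t + 1, B - pay q b, G + gain q b, real (t + 1) \<ge> \<rho> * real T))
       (1, \<rho> * real T, 0, False)"

definition S_bids :: "real \<Rightarrow> nat \<Rightarrow> (nat \<Rightarrow> request) \<Rightarrow> nat \<Rightarrow> real" where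
  "S_bids \<rho> T \<gamma> t =
     (case S_first_phase \<rho> T \<gamma> of (s, B, G, exited) \<Rightarrow>
        let K = s - 1; n = T - K in
        if t \<le> K then valuation (\<gamma> t)
        else if exited then 0
        else A_bids n (B / real n) (\<lambda>i. \<gamma> (K + i)) (t - K))"

end

theory Submission
  imports Defs
begin

text \<open>While its budget lasts, Algorithm A bids the maximizer of the Lagrangian of the current round
  at multipliers \<open>(l, m)\<close>, so its reward in a round is the dual value of that round minus
  \<open>l * g\<close> and \<open>m * (r - p)\<close>. The multiplicative and gradient updates make the sums of these two terms
  \<open>O(sqrt n)\<close> on every path, and keep the total gain above \<open>- sqrt n * ln (1 + 2 * sqrt n)\<close>; the gain
  collected in the first phase of Algorithm S covers this deficit. The multipliers of a round are
  independent of its request, so by weak duality the expected dual value is at least the expected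
  hindsight optimum per round, up to the factor \<open>min 1 (r / \<rho>)\<close> for the budget spent in the first
  phase. Finally the gains in the first phase have mean \<open>\<beta>\<close> each and stop just above
  \<open>2 * sqrt T * ln T\<close>, so by Wald's argument the first phase has expected length
  \<open>O(sqrt T * ln T)\<close>.\<close>

section \<open>Truthful requests\<close>

text \<open>Two random times shape the argument: the length K of the first phase, which fixes
  horizon and rate of the second, and the round in which the budget runs out. Instead of conditional
  expectations and stopping theorems, each path carries sums over fixed indices in which these times
  appear as indicators. Every summand has coefficients determined by earlier requests and a
  nonnegative mean over the current one, so integrating out a single coordinate of the product
  measure settles its sign. The hindsight optimum enters only through the number \<phi>, its mean
  per round. Pathwise bounds compare the reward with T * \<phi>, and the completion of the measure
  matters for \<phi> alone. The rate \<open>r\<close> of the second phase is random, while the loss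
  of Algorithm A grows with 1 / r. Paths whose first phase consumes a fixed share of the horizon or
  of the budget are therefore treated separately: there the trivial loss T is already of order K. On
  all others r \<ge> \<rho> / 2, so the constants depend on \<rho> only, and \<beta> enters just
  through the expected length of the first phase.\<close>

lemma set_integrable_alloc:
  assumes "q \<in> truthful_requests"
  shows "set_integrable lborel {0..b} (alloc q)"
proof -
  \<comment> \<open>Clamping at 0 gives a function that is monotone on the whole line, hence Borel,
    and agrees with the allocation on the interval.\<close>
  let ?x = "\<lambda>z. alloc q (max 0 z)"
  have "mono ?x"
    using assms by (auto simp: truthful_requests_def mono_on_def intro!: monoI)
  then have [measurable]: "?x \<in> borel_measurable borel"
    by (rule borel_measurable_mono)
  have "set_integrable lborel {0..b} ?x"
    unfolding set_integrable_def
  proof (rule integrableI_bounded_set_indicator[where B=1])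
    show "AE z in lborel. z \<in> {0..b} \<longrightarrow> norm (?x z) \<le> 1"
      using assms by (auto simp: truthful_requests_def)
  qed (auto simp: emeasure_lborel_Icc_eq)
  moreover have "(\<lambda>z. indicator {0..b} z *\<^sub>R ?x z) = (\<lambda>z. indicator {0..b} z *\<^sub>R alloc q z)"
    by (auto simp: indicator_def fun_eq_iff)
  ultimately show ?thesis
    by (simp add: set_integrable_def)
qed

lemma alloc_integrable_on:
  assumes "q \<in> truthful_requests" "0 \<le> a"
  shows "alloc q integrable_on {a..b}"
proof -
  have "alloc q integrable_on {0..b}"
    using set_integrable_alloc[OF assms(1)] by (rule set_borel_integral_eq_integral)
  then show ?thesis
    by (rule integrable_on_subinterval) (use assms(2) in auto)
qed

text \<open>The utility lost by bidding \<open>b\<close> instead of \<open>w\<close> is the integral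
  of x(z) - x(b) from \<open>b\<close> to \<open>w\<close>, nonnegative by monotonicity in either
  order of the endpoints. \<open>w\<close> is arbitrary rather than the valuation, because it will
  be the rescaled value \<open>dual_bid\<close>.\<close>

lemma truthful_bid_optimal:
  assumes q: "q \<in> truthful_requests" and b: "0 \<le> b" and w: "0 \<le> w"
  shows "w * alloc q b - pay q b \<le> w * alloc q w - pay q w"
proof -
  have mono: "alloc q y \<le> alloc q z" if "0 \<le> y" "y \<le> z" for y z
    using q that by (auto simp: truthful_requests_def mono_on_def)
  have pay: "pay q z = z * alloc q z - integral {0..z} (alloc q)" if "0 \<le> z" for z
    using q that unfolding truthful_requests_def by blast
  have split: "integral {0..z} (alloc q) = integral {0..y} (alloc q) + integral {y..z} (alloc q)"
    if "0 \<le> y" "y \<le> z" for y z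
    using Henstock_Kurzweil_Integration.integral_combine[OF that alloc_integrable_on[OF q]] by simp
  show ?thesis
  proof (cases "b \<le> w")
    case True
    have "integral {b..w} (\<lambda>_. alloc q b) \<le> integral {b..w} (alloc q)"
      by (rule integral_le) (use b mono alloc_integrable_on[OF q] in auto)
    then show ?thesis
      using True by (simp add: pay b w split[OF b True] algebra_simps)
  next
    case False
    then have wb: "w \<le> b" by simp
    have "integral {w..b} (alloc q) \<le> integral {w..b} (\<lambda>_. alloc q b)"
      by (rule integral_le) (use w mono alloc_integrable_on[OF q] in auto)
    then show ?thesis
      using wb by (simp add: pay b w split[OF w wb] algebra_simps)
  qed
qed

lemma truthful_bounds:
  assumes "q \<in> truthful_requests" "0 \<le> b"
  shows "0 \<le> alloc q b" "alloc q b \<le> 1" "0 \<le> pay q b" "pay q b \<le> 1"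
  using assms unfolding truthful_requests_def by blast+

lemma valuation_bounds:
  assumes "q \<in> truthful_requests"
  shows "0 \<le> valuation q" "valuation q \<le> 1"
  using assms unfolding truthful_requests_def by blast+

lemma value_bounds:
  assumes "q \<in> truthful_requests" "0 \<le> b"
  shows "0 \<le> valuation q * alloc q b" "valuation q * alloc q b \<le> 1"
  using truthful_bounds[OF assms] valuation_bounds[OF assms(1)] by (auto intro: mult_le_one)

lemma pay_zero:
  assumes "q \<in> truthful_requests"
  shows "pay q 0 = 0"
proof -
  have "pay q 0 = 0 * alloc q 0 - integral {0..0} (alloc q)"
    using assms unfolding truthful_requests_def by blast
  then show ?thesis by simp
qed

lemma gain_bounds:
  assumes "q \<in> truthful_requests" "0 \<le> b"
  shows "- 1 \<le> gain q b" "gain q b \<le> 1"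
  using truthful_bounds[OF assms] value_bounds[OF assms] by (auto simp: gain_def)

text \<open>A bid of 0 costs nothing although it may win, so rounds bid at 0 never hurt the
  return-on-spend constraint.\<close>

lemma gain_zero_nonneg:
  assumes "q \<in> truthful_requests"
  shows "0 \<le> gain q 0"
  using value_bounds[OF assms, of 0] pay_zero[OF assms] by (auto simp: gain_def)

lemma truthful_utility_nonneg:
  assumes "q \<in> truthful_requests" "0 \<le> w"
  shows "0 \<le> w * alloc q w - pay q w"
proof -
  have "0 \<le> w * alloc q 0 - pay q 0"
    using assms truthful_bounds[OF assms(1), of 0] pay_zero[OF assms(1)] by simp
  also have "\<dots> \<le> w * alloc q w - pay q w"
    using assms by (intro truthful_bid_optimal) auto
  finally show ?thesis .
qed

lemma gain_valuation_nonneg: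
  assumes "q \<in> truthful_requests"
  shows "0 \<le> gain q (valuation q)"
  using truthful_utility_nonneg[OF assms valuation_bounds(1)[OF assms]] by (simp add: gain_def)


section \<open>Lagrangian duality\<close>

definition dual_bid :: "real \<Rightarrow> real \<Rightarrow> request \<Rightarrow> real" where
  "dual_bid l m q = (1 + l) / (m + l) * valuation q"

text \<open>\<open>l\<close> prices the return-on-spend constraint and \<open>m\<close> the budget.
  \<open>r\<close> is a budget per round, so the sum over T rounds is the Lagrangian of the problem
  with budget r * T.\<close>

definition lagrangian :: "real \<Rightarrow> real \<Rightarrow> real \<Rightarrow> request \<Rightarrow> real \<Rightarrow> real" where
  "lagrangian l m r q b = valuation q * alloc q b + l * gain q b + m * (r - pay q b)"

text \<open>The supremum of the Lagrangian over all bids is attained at \<open>dual_bid\<close>;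
  evaluating there avoids a supremum, whose measurability would be an issue.\<close>

definition dual :: "real \<Rightarrow> real \<Rightarrow> real \<Rightarrow> request \<Rightarrow> real" where
  "dual l m r q = lagrangian l m r q (dual_bid l m q)"

lemma dual_bid_nonneg:
  assumes "q \<in> truthful_requests" "l > 0" "m \<ge> 0"
  shows "0 \<le> dual_bid l m q"
  using assms valuation_bounds[OF assms(1)] by (auto simp: dual_bid_def)

text \<open>Up to the constant m * r, the Lagrangian is m + l times the utility of a bidder whose
  value is \<open>dual_bid\<close>. This is the origin of the factor (1 + l) / (m + l): truthfulness
  makes bidding that value optimal.\<close>

lemma lagrangian_eq:
  assumes "l > 0" "m \<ge> 0"
  shows "lagrangian l m r q b = (m + l) * (dual_bid l m q * alloc q b - pay q b) + m * r"
proof -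
  have "(m + l) * dual_bid l m q = (1 + l) * valuation q"
    using assms by (simp add: dual_bid_def)
  then have "(m + l) * (dual_bid l m q * alloc q b) = (1 + l) * valuation q * alloc q b"
    by (metis mult.assoc)
  then show ?thesis
    by (simp add: lagrangian_def gain_def algebra_simps)
qed

lemma lagrangian_le_dual:
  assumes "q \<in> truthful_requests" "l > 0" "m \<ge> 0" "0 \<le> b"
  shows "lagrangian l m r q b \<le> dual l m r q"
  unfolding dual_def lagrangian_eq[OF assms(2,3)]
  using truthful_bid_optimal[OF assms(1,4) dual_bid_nonneg[OF assms(1-3)]] assms
  by (intro add_right_mono mult_left_mono) auto

lemma dual_bounds:
  assumes "q \<in> truthful_requests" "l > 0" "m \<ge> 0"
  shows "m * r \<le> dual l m r q" "dual l m r q \<le> 1 + l + m * r"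
proof -
  have b: "0 \<le> dual_bid l m q"
    by (rule dual_bid_nonneg) fact+
  have "0 \<le> (m + l) * (dual_bid l m q * alloc q (dual_bid l m q) - pay q (dual_bid l m q))"
    using truthful_utility_nonneg[OF assms(1) b] assms by (intro mult_nonneg_nonneg) auto
  then show "m * r \<le> dual l m r q"
    by (simp add: dual_def lagrangian_eq assms)
  have "l * gain q (dual_bid l m q) \<le> l * 1"
    using gain_bounds[OF assms(1) b] assms by (intro mult_left_mono) auto
  moreover have "m * (r - pay q (dual_bid l m q)) \<le> m * r"
    using truthful_bounds[OF assms(1) b] assms by (intro mult_left_mono) auto
  ultimately show "dual l m r q \<le> 1 + l + m * r"
    using value_bounds[OF assms(1) b] by (simp add: dual_def lagrangian_def)
qed

text \<open>The dual value is a nonnegative part free of the rate, plus \<open>m\<close> times the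
  rate. The factor shrinks the first part and turns \<rho> into at most \<open>r\<close>. This
  compares the rate left after the first phase with the rate of the benchmark.\<close>

lemma dual_scale_budget:
  assumes "q \<in> truthful_requests" "l > 0" "m \<ge> 0" "r \<ge> 0" "\<rho> > 0"
  shows "min 1 (r / \<rho>) * dual l m \<rho> q \<le> dual l m r q"
proof -
  let ?f = "dual l m 0 q"
  have f: "dual l m s q = ?f + m * s" for s
    by (simp add: dual_def lagrangian_def algebra_simps)
  have f0: "0 \<le> ?f"
    using dual_bounds[OF assms(1-3), of 0] by simp
  have c: "min 1 (r / \<rho>) \<le> 1" "min 1 (r / \<rho>) * \<rho> \<le> r"
    using assms by (auto simp: min_def field_simps)
  have "min 1 (r / \<rho>) * dual l m \<rho> q = min 1 (r / \<rho>) * ?f + m * (min 1 (r / \<rho>) * \<rho>)"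
    by (subst f) (simp add: algebra_simps)
  also have "\<dots> \<le> 1 * ?f + m * r"
    using c f0 assms by (intro add_mono mult_right_mono mult_left_mono) auto
  finally show ?thesis
    by (simp add: f[of r])
qed

text \<open>At rate 0 the dual value is nonnegative, so a loss l * g is compensated by the value won
  in the same round, which is at most 1, however large \<open>l\<close> is.\<close>

lemma dual_bid_gain_ge:
  assumes "q \<in> truthful_requests" "l > 0" "m \<ge> 0"
  shows "- 1 \<le> l * gain q (dual_bid l m q)"
proof -
  let ?b = "dual_bid l m q"
  have b: "0 \<le> ?b"
    by (rule dual_bid_nonneg) fact+
  have "0 \<le> valuation q * alloc q ?b + l * gain q ?b - m * pay q ?b"
    using dual_bounds(1)[OF assms, of 0] by (simp add: dual_def lagrangian_def)
  moreover have "0 \<le> m * pay q ?b"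
    using truthful_bounds[OF assms(1) b] assms by simp
  ultimately show ?thesis
    using value_bounds[OF assms(1) b] by linarith
qed

lemma
  assumes \<gamma>: "\<And>t. t \<in> {1..T} \<Longrightarrow> \<gamma> t \<in> truthful_requests"
    and b: "\<And>t. t \<in> {1..T} \<Longrightarrow> 0 \<le> b t"
  shows reward_nonneg: "0 \<le> reward T \<gamma> b"
    and reward_le: "reward T \<gamma> b \<le> real T"
proof -
  show "0 \<le> reward T \<gamma> b"
    unfolding reward_def by (intro sum_nonneg value_bounds \<gamma> b)
  have "reward T \<gamma> b \<le> (\<Sum>t=1..T. 1)"
    unfolding reward_def by (intro sum_mono value_bounds \<gamma> b)
  then show "reward T \<gamma> b \<le> real T" by simp
qed

text \<open>Ensures that the supremum in \<open>opt_reward\<close> ranges over a nonempty set, and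
  yields its nonnegativity.\<close>

lemma zero_feasible:
  assumes \<gamma>: "\<And>t. t \<in> {1..T} \<Longrightarrow> \<gamma> t \<in> truthful_requests" and \<rho>: "\<rho> > 0"
  shows "(\<lambda>_. 0) \<in> feasible_bids \<rho> T \<gamma>"
proof -
  have "spend T \<gamma> (\<lambda>_. 0) = 0"
    unfolding spend_def by (intro sum.neutral ballI pay_zero \<gamma>)
  then show ?thesis
    using \<rho> reward_nonneg[of T \<gamma> "\<lambda>_. 0", OF \<gamma>]
    by (simp add: feasible_bids_def satisfies_RoS_def satisfies_budget_def)
qed

text \<open>Weak duality: for feasible bids both constraint slacks are nonnegative, so adding them
  with weights \<open>l\<close> and \<open>m\<close> only raises the value. The multipliers are the
  same in all rounds, which later allows them to be frozen at the state of any one round.\<close>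

lemma
  assumes \<gamma>: "\<And>t. t \<in> {1..T} \<Longrightarrow> \<gamma> t \<in> truthful_requests" and \<rho>: "\<rho> > 0"
  shows opt_reward_nonneg: "0 \<le> opt_reward \<rho> T \<gamma>"
    and opt_reward_le: "opt_reward \<rho> T \<gamma> \<le> real T"
    and opt_reward_le_dual:
      "l > 0 \<Longrightarrow> m \<ge> 0 \<Longrightarrow> opt_reward \<rho> T \<gamma> \<le> (\<Sum>t=1..T. dual l m \<rho> (\<gamma> t))"
proof -
  have ubT: "reward T \<gamma> b \<le> real T" if "b \<in> feasible_bids \<rho> T \<gamma>" for b
    using that by (intro reward_le[OF \<gamma>]) (auto simp: feasible_bids_def)
  have ne: "feasible_bids \<rho> T \<gamma> \<noteq> {}"
    using zero_feasible[of T \<gamma>, OF \<gamma> \<rho>] by blast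
  show "opt_reward \<rho> T \<gamma> \<le> real T"
    unfolding opt_reward_def by (rule cSUP_least[OF ne ubT])
  have "0 \<le> reward T \<gamma> (\<lambda>_. 0)"
    by (intro reward_nonneg[OF \<gamma>]) auto
  also have "\<dots> \<le> opt_reward \<rho> T \<gamma>"
    unfolding opt_reward_def
    by (rule cSUP_upper[OF zero_feasible[of T \<gamma>, OF \<gamma> \<rho>]]) (use ubT in \<open>auto intro!: bdd_aboveI\<close>)
  finally show "0 \<le> opt_reward \<rho> T \<gamma>" .
  assume l: "l > 0" and m: "m \<ge> 0"
  have "reward T \<gamma> b \<le> (\<Sum>t=1..T. dual l m \<rho> (\<gamma> t))" if "b \<in> feasible_bids \<rho> T \<gamma>" for b
  proof -
    have *: "(\<Sum>t=1..T. gain (\<gamma> t) (b t)) = reward T \<gamma> b - spend T \<gamma> b"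
      by (simp add: gain_def reward_def spend_def sum_subtractf)
    have "reward T \<gamma> b \<le> reward T \<gamma> b + l * (reward T \<gamma> b - spend T \<gamma> b) + m * (\<rho> * T - spend T \<gamma> b)"
      using that l m by (simp add: feasible_bids_def satisfies_RoS_def satisfies_budget_def)
    also have "\<dots> = (\<Sum>t=1..T. lagrangian l m \<rho> (\<gamma> t) (b t))"
      unfolding *[symmetric] unfolding lagrangian_def reward_def spend_def sum.distrib
        sum_distrib_left[symmetric] sum_subtractf by (simp add: mult.commute)
    also have "\<dots> \<le> (\<Sum>t=1..T. dual l m \<rho> (\<gamma> t))"
    proof (intro sum_mono lagrangian_le_dual \<gamma> l m)
      show "0 \<le> b t" if "t \<in> {1..T}" for t
        using that \<open>b \<in> feasible_bids \<rho> T \<gamma>\<close> by (simp add: feasible_bids_def)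
    qed
    finally show ?thesis .
  qed
  then show "opt_reward \<rho> T \<gamma> \<le> (\<Sum>t=1..T. dual l m \<rho> (\<gamma> t))"
    unfolding opt_reward_def by (rule cSUP_least[OF ne])
qed


section \<open>Pathwise analysis of Algorithm A\<close>

lemma exp_minus_le_quadratic:
  fixes x :: real
  assumes "\<bar>x\<bar> \<le> 1"
  shows "exp (- x) \<le> 1 - x + x\<^sup>2"
proof (cases "0 \<le> x")
  case True
  have p: "1 + x + x\<^sup>2 / 2 > 0"
    using True by (intro add_pos_nonneg) auto
  \<comment> \<open>The product expands to 1 + (x^2 + x^3 + x^4) / 2. Dividing turns the quadratic
    lower bound of exp into an upper bound for its reciprocal.\<close>
  have "1 \<le> (1 - x + x\<^sup>2) * (1 + x + x\<^sup>2 / 2)"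
  proof -
    have "(1 - x + x\<^sup>2) * (1 + x + x\<^sup>2 / 2) = 1 + (x\<^sup>2 + x ^ 3 + x ^ 4) / 2"
      by (simp add: field_simps power2_eq_square power3_eq_cube power4_eq_xxxx)
    then show ?thesis using True by simp
  qed
  then have "inverse (1 + x + x\<^sup>2 / 2) \<le> 1 - x + x\<^sup>2"
    using p by (simp add: field_simps)
  moreover have "exp (- x) \<le> inverse (1 + x + x\<^sup>2 / 2)"
    using exp_lower_Taylor_quadratic[OF True] p by (simp add: exp_minus le_imp_inverse_le)
  ultimately show ?thesis by simp
next
  case False
  then show ?thesis
    using exp_bound[of "- x"] assms by simp
qed

text \<open>The multiplicative update loses little because the bids of Algorithm A keep
  \<open>l * g \<ge> - 1\<close> even when the multiplier \<open>l\<close> is large.\<close>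

lemma multiplicative_update_bounds:
  fixes l g \<alpha> :: real
  assumes l: "0 < l" and g: "\<bar>g\<bar> \<le> 1" and lg: "- 1 \<le> l * g" and \<alpha>: "0 \<le> \<alpha>" "\<alpha> \<le> 1"
  shows "l * exp (- \<alpha> * g) \<le> l - (\<alpha> - \<alpha>\<^sup>2) * (l * g) + 2 * \<alpha>\<^sup>2"
    and "l * exp (- \<alpha> * g) \<le> l + 2 * \<alpha>"
proof -
  have \<alpha>g: "\<bar>\<alpha> * g\<bar> \<le> 1"
    using g \<alpha> by (simp add: abs_mult mult_le_one)
  have e: "l * exp (- \<alpha> * g) \<le> l * (1 - \<alpha> * g + (\<alpha> * g)\<^sup>2)"
    using exp_minus_le_quadratic[OF \<alpha>g] l by simp
  \<comment> \<open>For negative \<open>g\<close> the left side is at most - l * g, which exceeds l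
    * g by at most 2 because l * g \<ge> - 1.\<close>
  have sq: "l * g\<^sup>2 \<le> l * g + 2"
  proof (cases "0 \<le> g")
    case True
    then have "g * g \<le> g" using g by (simp add: mult_left_le)
    then have "l * g\<^sup>2 \<le> l * g" using l by (simp add: power2_eq_square)
    then show ?thesis by simp
  next
    case False
    then have "g * g \<le> - g" using g mult_left_le[of "- g" "- g"] by simp
    then have "l * (g * g) \<le> l * (- g)" using l by (intro mult_left_mono) auto
    then show ?thesis using lg by (simp add: power2_eq_square)
  qed
  have "\<alpha>\<^sup>2 * (l * g\<^sup>2) \<le> \<alpha>\<^sup>2 * (l * g + 2)"
    using sq by (intro mult_left_mono) auto
  with e show "l * exp (- \<alpha> * g) \<le> l - (\<alpha> - \<alpha>\<^sup>2) * (l * g) + 2 * \<alpha>\<^sup>2"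
    by (simp add: algebra_simps power_mult_distrib)
  show "l * exp (- \<alpha> * g) \<le> l + 2 * \<alpha>"
  proof (cases "0 \<le> g")
    case True
    then have "l * exp (- \<alpha> * g) \<le> l"
      using l \<alpha> by (simp add: mult_le_cancel_left1)
    then show ?thesis using \<alpha> by simp
  next
    case False
    then have "(\<alpha> * g)\<^sup>2 \<le> - (\<alpha> * g)"
      using \<alpha>g mult_left_le[of "- (\<alpha> * g)" "- (\<alpha> * g)"] \<alpha>
      by (simp add: power2_eq_square mult_nonneg_nonpos)
    then have "l * (1 - \<alpha> * g + (\<alpha> * g)\<^sup>2) \<le> l * (1 - 2 * (\<alpha> * g))"
      using l by (intro mult_left_mono) auto
    moreover have "\<alpha> * (- (l * g)) \<le> \<alpha> * 1"
      using lg \<alpha> by (intro mult_left_mono) auto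
    ultimately show ?thesis using e by (simp add: algebra_simps)
  qed
qed

section \<open>Gain and the return-on-spend multiplier along a run of Algorithm A\<close>

lemma A_state_positive:
  "0 < fst (A_state_after n r \<gamma> k) \<and> 0 \<le> fst (snd (A_state_after n r \<gamma> k))"
proof (induction k)
  case (Suc k)
  then show ?case
    by (cases "A_state_after n r \<gamma> k") (simp add: Let_def)
qed simp

locale A_run =
  fixes n :: nat and r :: real and \<gamma> :: "nat \<Rightarrow> request"
  assumes truthful: "\<And>i. i \<in> {1..n} \<Longrightarrow> \<gamma> i \<in> truthful_requests"
    and n: "n \<ge> 1" and r: "r \<ge> 0"
begin

text \<open>The index counts completed rounds: \<open>l k\<close>, \<open>m k\<close> and
  \<open>B k\<close> are the values with which round \<open>Suc k\<close> is bid.\<close>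

definition l :: "nat \<Rightarrow> real" where "l k = fst (A_state_after n r \<gamma> k)"
definition m :: "nat \<Rightarrow> real" where "m k = fst (snd (A_state_after n r \<gamma> k))"
definition B :: "nat \<Rightarrow> real" where "B k = snd (snd (A_state_after n r \<gamma> k))"

abbreviation "bid \<equiv> A_bids n r \<gamma>"
abbreviation "g k \<equiv> gain (\<gamma> k) (bid k)"
abbreviation "p k \<equiv> pay (\<gamma> k) (bid k)"

lemma state_eq: "A_state_after n r \<gamma> k = (l k, m k, B k)"
  by (simp add: l_def m_def B_def)

lemma bid_Suc: "bid (Suc k) = (if B k \<ge> 1 then dual_bid (l k) (m k) (\<gamma> (Suc k)) else 0)"
  by (simp add: A_bids_def state_eq dual_bid_def)

lemma init [simp]: "l 0 = 1" "m 0 = 0" "B 0 = r * n"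
  by (simp_all add: l_def m_def B_def)

lemma
  shows l_Suc: "l (Suc k) = l k * exp (- (1 / sqrt n) * g (Suc k))"
    and m_Suc: "m (Suc k) = max 0 (m k - 1 / ((1 + r\<^sup>2) * sqrt n) * (r - p (Suc k)))"
    and B_Suc: "B (Suc k) = B k - p (Suc k)"
proof -
  have "A_state_after n r \<gamma> (Suc k) = A_update n r (\<gamma> (Suc k)) (l k, m k, B k)"
    by (simp add: state_eq)
  moreover have "A_bid_in (l k, m k, B k) (valuation (\<gamma> (Suc k))) = bid (Suc k)"
    by (simp add: A_bids_def state_eq)
  ultimately have "(l (Suc k), m (Suc k), B (Suc k)) =
    (l k * exp (- (1 / sqrt n) * g (Suc k)),
     max 0 (m k - 1 / ((1 + r\<^sup>2) * sqrt n) * (r - p (Suc k))), B k - p (Suc k))"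
    by (simp only: state_eq[of "Suc k"] A_update.simps Let_def)
  then show "l (Suc k) = l k * exp (- (1 / sqrt n) * g (Suc k))"
    "m (Suc k) = max 0 (m k - 1 / ((1 + r\<^sup>2) * sqrt n) * (r - p (Suc k)))"
    "B (Suc k) = B k - p (Suc k)"
    by simp_all
qed

lemma l_pos: "l k > 0" and m_nonneg: "m k \<ge> 0"
  using A_state_positive[of n r \<gamma> k] by (auto simp: l_def m_def)

lemma bid_nonneg: "k < n \<Longrightarrow> 0 \<le> bid (Suc k)"
  using dual_bid_nonneg[OF truthful l_pos m_nonneg, of "Suc k"] by (simp add: bid_Suc)

lemma p_bounds: "k < n \<Longrightarrow> 0 \<le> p (Suc k)" "k < n \<Longrightarrow> p (Suc k) \<le> 1"
  using truthful_bounds[OF truthful bid_nonneg] by auto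

lemma l_gain_ge: "k < n \<Longrightarrow> - 1 \<le> l k * g (Suc k)"
  using dual_bid_gain_ge[OF truthful l_pos m_nonneg, of "Suc k"]
    mult_nonneg_nonneg[OF less_imp_le[OF l_pos] gain_zero_nonneg[OF truthful], of "Suc k" k]
  by (auto simp: bid_Suc)

lemma abs_gain_le: "k < n \<Longrightarrow> \<bar>g (Suc k)\<bar> \<le> 1"
  using gain_bounds[OF truthful[of "Suc k"] bid_nonneg[of k]] by auto

lemma step_size: "0 \<le> 1 / sqrt n" "1 / sqrt n \<le> 1"
  using n by auto

lemma l_le: "k \<le> n \<Longrightarrow> l k \<le> 1 + 2 * k * (1 / sqrt n)"
proof (induction k)
  case (Suc k)
  then have "l (Suc k) \<le> l k + 2 * (1 / sqrt n)"
    unfolding l_Suc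
    by (intro multiplicative_update_bounds l_pos abs_gain_le l_gain_ge step_size) auto
  with Suc show ?case by (simp add: field_simps)
qed simp

lemma l_eq: "l k = exp (- ((\<Sum>i<k. g (Suc i)) / sqrt n))"
  by (induction k) (auto simp: l_Suc add_divide_distrib simp flip: exp_add)

text \<open>The multiplier stores the total gain in its exponent, so the linear growth bound
  \<open>l_le\<close>, which reads 1 + 2 * sqrt n at the end, becomes a bound on the deficit after
  taking logarithms.\<close>

lemma gain_sum_ge: "- (sqrt n * ln (1 + 2 * sqrt n)) \<le> (\<Sum>i<n. g (Suc i))"
proof -
  have "real n * (1 / sqrt n) = sqrt n"
    using n by (simp add: real_div_sqrt)
  then have "exp (- ((\<Sum>i<n. g (Suc i)) / sqrt n)) \<le> 1 + 2 * sqrt n"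
    using l_le[of n] by (simp add: l_eq mult.assoc)
  then have "ln (exp (- ((\<Sum>i<n. g (Suc i)) / sqrt n))) \<le> ln (1 + 2 * sqrt n)"
    by (intro ln_mono) auto
  then have "- (\<Sum>i<n. g (Suc i)) \<le> sqrt n * ln (1 + 2 * sqrt n)"
    using n by (simp add: field_simps)
  then show ?thesis by simp
qed

text \<open>Summing the first update bound telescopes \<open>l\<close>: the initial value 1 and the
  second-order terms 2 * \<alpha>^2 add up to at most 3. For n \<ge> 4 the factor \<alpha> -
  \<alpha>^2 is at least \<alpha> / 2, whence 6 * sqrt n. \<open>k\<close> is free so that the sum
  can stop when the budget runs out.\<close>

lemma l_gain_sum_le:
  assumes "k \<le> n" and n4: "n \<ge> 4"
  shows "(\<Sum>i<k. l i * g (Suc i)) \<le> 6 * sqrt n"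
proof -
  define \<alpha> where "\<alpha> = 1 / sqrt n"
  let ?S = "\<lambda>k. \<Sum>i<k. l i * g (Suc i)"
  have "l k \<le> 1 - (\<alpha> - \<alpha>\<^sup>2) * ?S k + 2 * \<alpha>\<^sup>2 * k" if "k \<le> n" for k
    using that
  proof (induction k)
    case (Suc k)
    then have "l (Suc k) \<le> l k - (\<alpha> - \<alpha>\<^sup>2) * (l k * g (Suc k)) + 2 * \<alpha>\<^sup>2"
      unfolding l_Suc \<alpha>_def
      by (intro multiplicative_update_bounds l_pos abs_gain_le l_gain_ge step_size) auto
    with Suc show ?case by (simp add: algebra_simps)
  qed simp
  from this[OF assms(1)] have 1: "(\<alpha> - \<alpha>\<^sup>2) * ?S k \<le> 1 + 2 * (\<alpha>\<^sup>2 * k)"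
    using l_pos[of k] by simp
  have "\<alpha>\<^sup>2 * k \<le> 1"
    using assms by (simp add: \<alpha>_def power_divide field_simps)
  with 1 have S: "(\<alpha> - \<alpha>\<^sup>2) * ?S k \<le> 3"
    by simp
  have "sqrt 4 \<le> sqrt n" using n4 by (intro real_sqrt_le_mono) auto
  then have n2: "2 \<le> sqrt n" by simp
  show ?thesis
  proof (cases "?S k \<le> 0")
    case True
    moreover have "0 \<le> 6 * sqrt n" by simp
    ultimately show ?thesis by linarith
  next
    case False
    have "\<alpha> / 2 \<le> \<alpha> - \<alpha>\<^sup>2"
      using mult_left_mono[of \<alpha> "1 / 2" \<alpha>] n2
      by (simp add: \<alpha>_def power2_eq_square divide_simps del: real_sqrt_mult_self)
    then have "\<alpha> / 2 * ?S k \<le> 3"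
      using S False mult_right_mono[of "\<alpha> / 2" "\<alpha> - \<alpha>\<^sup>2" "?S k"] by linarith
    then have "?S k / (2 * sqrt n) \<le> 3"
      by (simp add: \<alpha>_def)
    then have "?S k \<le> 3 * (2 * sqrt n)"
      using n by (subst (asm) pos_divide_le_eq) auto
    then show ?thesis by simp
  qed
qed

section \<open>Budget and its multiplier along a run of Algorithm A\<close>

lemma m_le: "k \<le> n \<Longrightarrow> m k \<le> k"
proof (induction k)
  case (Suc k)
  define \<eta> where "\<eta> = 1 / ((1 + r\<^sup>2) * sqrt n)"
  \<comment> \<open>The step size is at most 1, and so is each p - r. The resulting linear bound is
    crude; it serves integrability.\<close>
  have "1 * 1 \<le> (1 + r\<^sup>2) * sqrt n"
    using n by (intro mult_mono) auto
  then have \<eta>: "0 \<le> \<eta>" "\<eta> \<le> 1"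
    by (auto simp: \<eta>_def)
  have "\<eta> * (p (Suc k) - r) \<le> \<eta> * 1"
    using \<eta> p_bounds(2)[of k] r Suc.prems by (intro mult_left_mono) auto
  then have "- (\<eta> * (r - p (Suc k))) \<le> 1"
    using \<eta> by (simp add: algebra_simps)
  then show ?case
    using Suc by (auto simp: m_Suc simp flip: \<eta>_def)
qed simp

lemma B_eq: "B k = r * n - (\<Sum>i<k. p (Suc i))"
  by (induction k) (auto simp: B_Suc)

lemma B_exhausted: "k < n \<Longrightarrow> B k < 1 \<Longrightarrow> B (Suc k) = B k"
  using pay_zero[OF truthful, of "Suc k"] by (simp add: B_Suc bid_Suc)

text \<open>A round pays at most 1 and is bid only while at least 1 is left; below 1 the budget
  stays frozen.\<close>

lemma B_nonneg: "k \<le> n \<Longrightarrow> 0 \<le> B k"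
proof (induction k)
  case (Suc k)
  then show ?case
    using p_bounds(2)[of k] B_exhausted[of k] by (cases "B k < 1") (auto simp: B_Suc)
qed (use r in auto)

lemma B_antimono: "j \<le> k \<Longrightarrow> k \<le> n \<Longrightarrow> B k \<le> B j"
proof (induction k rule: dec_induct)
  case (step k)
  then show ?case using p_bounds(1)[of k] by (simp add: B_Suc)
qed simp

text \<open>Regret of projected gradient descent against a fixed comparator \<open>u\<close>, by the
  potential (m - u)^2: clipping at 0 cannot move \<open>m\<close> away from a nonnegative
  \<open>u\<close>. As (r - p)^2 \<le> 1 + r^2, the factor 1 + r^2 in the step size cuts the
  second-order term down to sqrt n / 2.\<close>

lemma m_regret:
  assumes "k \<le> n" "u \<ge> 0"
  shows "(\<Sum>i<k. m i * (r - p (Suc i))) \<le>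
    u * (\<Sum>i<k. r - p (Suc i)) + u\<^sup>2 * (1 + r\<^sup>2) * sqrt n / 2 + sqrt n / 2"
proof -
  define \<eta> where "\<eta> = 1 / ((1 + r\<^sup>2) * sqrt n)"
  define c where "c i = r - p (Suc i)" for i
  have rp: "1 + r\<^sup>2 > 0"
    by (simp add: add_pos_nonneg)
  have \<eta>: "\<eta> > 0"
    using n rp by (simp add: \<eta>_def)
  have c2: "(c i)\<^sup>2 \<le> 1 + r\<^sup>2" if "i < n" for i
  proof -
    have "(p (Suc i))\<^sup>2 \<le> 1" "0 \<le> r * p (Suc i)"
      using p_bounds[OF that] r by (auto simp: power_le_one)
    then show ?thesis by (simp add: c_def power2_diff)
  qed
  have "(m k - u)\<^sup>2 + 2 * \<eta> * (\<Sum>i<k. c i * (m i - u)) \<le> u\<^sup>2 + \<eta>\<^sup>2 * (1 + r\<^sup>2) * k"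
    using assms(1)
  proof (induction k)
    case (Suc k)
    have "\<bar>m (Suc k) - u\<bar> \<le> \<bar>m k - \<eta> * c k - u\<bar>"
      using assms(2) by (auto simp: m_Suc max_def c_def simp flip: \<eta>_def)
    then have "(m (Suc k) - u)\<^sup>2 \<le> (m k - \<eta> * c k - u)\<^sup>2"
      by (simp add: abs_le_square_iff)
    also have "\<dots> = (m k - u)\<^sup>2 - 2 * \<eta> * (c k * (m k - u)) + \<eta>\<^sup>2 * (c k)\<^sup>2"
      by (simp add: power2_eq_square algebra_simps)
    also have "\<dots> \<le> (m k - u)\<^sup>2 - 2 * \<eta> * (c k * (m k - u)) + \<eta>\<^sup>2 * (1 + r\<^sup>2)"
      using c2[of k] Suc.prems by (intro add_left_mono mult_left_mono) auto
    finally show ?case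
      using Suc by (simp add: algebra_simps)
  qed simp
  moreover have "\<eta>\<^sup>2 * (1 + r\<^sup>2) * k \<le> \<eta>\<^sup>2 * (1 + r\<^sup>2) * n"
    using assms rp by (intro mult_left_mono) auto
  ultimately have "2 * \<eta> * (\<Sum>i<k. c i * (m i - u)) \<le> u\<^sup>2 + \<eta>\<^sup>2 * (1 + r\<^sup>2) * n"
    using zero_le_power2[of "m k - u"] by linarith
  moreover have "\<eta>\<^sup>2 * (1 + r\<^sup>2) * n = \<eta> * sqrt n"
  proof -
    have "\<eta> * (1 + r\<^sup>2) * sqrt n = 1"
      using n rp by (simp add: \<eta>_def)
    moreover have "\<eta>\<^sup>2 * (1 + r\<^sup>2) * n = \<eta> * (\<eta> * (1 + r\<^sup>2) * sqrt n) * sqrt n"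
      by (simp add: power2_eq_square)
    ultimately show ?thesis by simp
  qed
  ultimately have "(\<Sum>i<k. c i * (m i - u)) \<le> u\<^sup>2 / \<eta> / 2 + sqrt n / 2"
    using \<eta> by (simp add: field_simps)
  also have "u\<^sup>2 / \<eta> = u\<^sup>2 * (1 + r\<^sup>2) * sqrt n"
    by (simp add: \<eta>_def mult.assoc)
  also have "(\<Sum>i<k. c i * (m i - u)) = (\<Sum>i<k. m i * c i) - u * (\<Sum>i<k. c i)"
    by (simp add: sum_subtractf sum_distrib_left algebra_simps)
  finally show ?thesis
    by (simp add: c_def)
qed

text \<open>After the budget is exhausted, at most \<open>n - k\<close> rounds are lost; the comparator \<open>1 / r\<close>
  in the regret bound for \<open>m\<close> pays for exactly these rounds.\<close>

lemma reward_ge: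
  fixes \<kappa> :: real
  assumes n4: "n \<ge> 4" and r0: "r > 0" and \<kappa>: "0 \<le> \<kappa>" "\<kappa> \<le> 1"
  shows "(\<Sum>i<n. if B i \<ge> 1 then dual (l i) (m i) r (\<gamma> (Suc i)) - \<kappa> else 0) + n * \<kappa>
      - (7 * sqrt n + 1 / r + (1 + 1 / r\<^sup>2) * sqrt n / 2)
    \<le> (\<Sum>i<n. valuation (\<gamma> (Suc i)) * alloc (\<gamma> (Suc i)) (bid (Suc i)))"
proof -
  let ?v = "\<lambda>i. valuation (\<gamma> (Suc i)) * alloc (\<gamma> (Suc i)) (bid (Suc i))"
  let ?D = "\<lambda>i. dual (l i) (m i) r (\<gamma> (Suc i))"
  \<comment> \<open>The budget never rises, so \<open>dual_bid\<close> is bid exactly in rounds 1 to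
    \<open>k\<close>.\<close>
  define k where "k = (LEAST k. k = n \<or> B k < 1)"
  have k: "k = n \<or> B k < 1"
    unfolding k_def by (rule LeastI[of _ n]) simp
  have kn: "k \<le> n"
    unfolding k_def by (rule Least_le) simp
  have before: "B i \<ge> 1" if "i < k" for i
    using not_less_Least[of i "\<lambda>k. k = n \<or> B k < 1"] that by (auto simp: k_def)
  have after: "\<not> B i \<ge> 1" if "k \<le> i" "i < n" for i
    using k B_antimono[of k i] that by auto
  have split: "sum f {..<n} = sum f {..<k} + sum f {k..<n}" for f :: "nat \<Rightarrow> real"
    using kn sum.atLeastLessThan_concat[of 0 k n f]
    by (simp add: atLeast0LessThan)
  \<comment> \<open>The summands have the shape that \<open>drift\<close> takes later: rounds
    without budget contribute 0, so the random stopping point does not show in the index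
    range.\<close>
  have D: "(\<Sum>i<n. if B i \<ge> 1 then ?D i - \<kappa> else 0) = (\<Sum>i<k. ?D i) - k * \<kappa>"
  proof -
    have "(\<Sum>i=k..<n. if B i \<ge> 1 then ?D i - \<kappa> else 0) = 0"
      by (intro sum.neutral) (use after in auto)
    moreover have "(\<Sum>i<k. if B i \<ge> 1 then ?D i - \<kappa> else 0) = (\<Sum>i<k. ?D i - \<kappa>)"
      by (intro sum.cong) (use before in auto)
    ultimately show ?thesis
      unfolding split by (simp add: sum_subtractf)
  qed
  have v: "?v i = ?D i - l i * g (Suc i) - m i * (r - p (Suc i))" if "i < k" for i
    using before[OF that] by (simp add: dual_def lagrangian_def bid_Suc)
  have "(\<Sum>i<k. ?v i) = (\<Sum>i<k. ?D i) - (\<Sum>i<k. l i * g (Suc i)) - (\<Sum>i<k. m i * (r - p (Suc i)))"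
    by (simp add: v sum_subtractf)
  moreover have "(\<Sum>i<k. l i * g (Suc i)) \<le> 6 * sqrt n"
    by (rule l_gain_sum_le) fact+
  moreover have "(\<Sum>i<k. m i * (r - p (Suc i)))
      \<le> - (real n - real k) * \<kappa> + 1 / r + (1 + 1 / r\<^sup>2) * sqrt n / 2 + sqrt n / 2"
  \<comment> \<open>If the budget lasts, the comparator is 0. Otherwise B k < 1 bounds the sum of r
    - p by 1 - r * (n - k), and the comparator 1 / r turns this into 1 / r - (n - k), which suffices
    as \<kappa> \<le> 1.\<close>
  proof (cases "k = n")
    case True
    have "0 \<le> 1 / r + (1 + 1 / r\<^sup>2) * sqrt n / 2"
      using r0 by (intro add_nonneg_nonneg divide_nonneg_nonneg mult_nonneg_nonneg) auto
    then show ?thesis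
      using m_regret[OF kn, of 0] unfolding True by simp
  next
    case False
    have "(\<Sum>i<k. r - p (Suc i)) = B k - r * n + r * k"
      by (simp add: B_eq sum_subtractf)
    also have "\<dots> \<le> 1 - r * (real n - real k)"
      using False k by (simp add: algebra_simps)
    finally have "1 / r * (\<Sum>i<k. r - p (Suc i)) \<le> 1 / r * (1 - r * (real n - real k))"
      using r0 by (intro mult_left_mono) auto
    also have "\<dots> = 1 / r - (real n - real k)"
      using r0 by (simp add: field_simps)
    finally have "1 / r * (\<Sum>i<k. r - p (Suc i)) \<le> - (real n - real k) * \<kappa> + 1 / r"
      using \<kappa> kn mult_left_le[of \<kappa> "real n - real k"] by (simp add: algebra_simps)
    moreover have "(1 / r)\<^sup>2 * (1 + r\<^sup>2) = 1 + 1 / r\<^sup>2"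
      using r0 by (simp add: field_simps)
    ultimately show ?thesis
      using m_regret[OF kn, of "1 / r"] r0 by simp
  qed
  moreover have "(\<Sum>i<k. ?v i) \<le> (\<Sum>i<n. ?v i)"
    by (intro sum_mono2) (use kn value_bounds[OF truthful bid_nonneg] in auto)
  ultimately show ?thesis
    unfolding D by (simp add: algebra_simps) (use real_sqrt_ge_zero[of n] in linarith)
qed

end


section \<open>Pathwise analysis of Algorithm S\<close>

lemma while_eq_Least:
  assumes "\<exists>k. \<not> b ((c ^^ k) s)"
  shows "while b c s = (c ^^ (LEAST k. \<not> b ((c ^^ k) s))) s"
  using assms by (simp add: while_def while_option_def)

definition first_gain :: "(nat \<Rightarrow> request) \<Rightarrow> nat \<Rightarrow> real" where
  "first_gain \<gamma> k = (\<Sum>i<k. gain (\<gamma> (Suc i)) (valuation (\<gamma> (Suc i))))"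

definition first_pay :: "(nat \<Rightarrow> request) \<Rightarrow> nat \<Rightarrow> real" where
  "first_pay \<gamma> k = (\<Sum>i<k. pay (\<gamma> (Suc i)) (valuation (\<gamma> (Suc i))))"

text \<open>The exit test comes at the end of an iteration, so never before the first round; after
  \<open>k\<close> rounds the round counter is k + 1.\<close>

definition exits :: "real \<Rightarrow> nat \<Rightarrow> nat \<Rightarrow> bool" where
  "exits \<rho> T k \<longleftrightarrow> 1 \<le> k \<and> \<rho> * real T \<le> real (k + 1)"

definition continues :: "real \<Rightarrow> nat \<Rightarrow> (nat \<Rightarrow> request) \<Rightarrow> nat \<Rightarrow> bool" where
  "continues \<rho> T \<gamma> k \<longleftrightarrow>
     \<not> exits \<rho> T k \<and> k < T \<and> first_gain \<gamma> k \<le> 2 * sqrt (real T) * ln (real T)"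

definition phase_length :: "real \<Rightarrow> nat \<Rightarrow> (nat \<Rightarrow> request) \<Rightarrow> nat" where
  "phase_length \<rho> T \<gamma> = (LEAST k. \<not> continues \<rho> T \<gamma> k)"

definition remaining_rate :: "real \<Rightarrow> nat \<Rightarrow> (nat \<Rightarrow> request) \<Rightarrow> nat \<Rightarrow> real" where
  "remaining_rate \<rho> T \<gamma> k = (\<rho> * real T - first_pay \<gamma> k) / real (T - k)"

definition delayed :: "nat \<Rightarrow> (nat \<Rightarrow> request) \<Rightarrow> nat \<Rightarrow> request" where
  "delayed k \<gamma> i = \<gamma> (k + i)"

lemma not_continues_phase_length: "\<not> continues \<rho> T \<gamma> (phase_length \<rho> T \<gamma>)"
  unfolding phase_length_def by (rule LeastI[of _ T]) (simp add: continues_def)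

lemma phase_length_le: "phase_length \<rho> T \<gamma> \<le> T"
  unfolding phase_length_def by (rule Least_le) (simp add: continues_def)

lemma continues_before: "k < phase_length \<rho> T \<gamma> \<Longrightarrow> continues \<rho> T \<gamma> k"
  unfolding phase_length_def using not_less_Least by blast

text \<open>Stopping time property: the event is decided by the first \<open>k\<close> requests,
  since \<open>continues\<close> at \<open>j\<close> reads the gain of the first \<open>j\<close>
  only.\<close>

lemma phase_length_eq_iff:
  "phase_length \<rho> T \<gamma> = k \<longleftrightarrow> (\<forall>j<k. continues \<rho> T \<gamma> j) \<and> \<not> continues \<rho> T \<gamma> k"
  using not_continues_phase_length[of \<rho> T \<gamma>] continues_before[of _ \<rho> T \<gamma>]
  by (metis linorder_neqE_nat)

lemma less_phase_length_iff: "k < phase_length \<rho> T \<gamma> \<longleftrightarrow> (\<forall>j\<le>k. continues \<rho> T \<gamma> j)"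
  using not_continues_phase_length[of \<rho> T \<gamma>] continues_before[of _ \<rho> T \<gamma>]
  by (meson le_less_trans not_le)

text \<open>The gain starts at 0 and the exit test comes after the bid, so one truthful bid is
  placed however small the budget is.\<close>

lemma phase_length_pos:
  assumes "T \<ge> 1"
  shows "phase_length \<rho> T \<gamma> \<ge> 1"
proof -
  have "continues \<rho> T \<gamma> 0"
    using assms by (simp add: continues_def exits_def first_gain_def)
  then show ?thesis
    by (metis One_nat_def Suc_leI gr0I not_continues_phase_length)
qed

lemma S_first_phase_eq:
  "S_first_phase \<rho> T \<gamma> =
    (let K = phase_length \<rho> T \<gamma> in
      (K + 1, \<rho> * real T - first_pay \<gamma> K, first_gain \<gamma> K, exits \<rho> T K))"
proof -
  let ?b = "\<lambda>(t, B, G, e). \<not> e \<and> t \<le> T \<and> G \<le> 2 * sqrt (real T) * ln (real T)"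
  let ?c = "\<lambda>(t, B, G, e::bool).
          let q = \<gamma> t; b = valuation q
          in (t + 1, B - pay q b, G + gain q b, real (t + 1) \<ge> \<rho> * real T)"
  let ?s = "(1::nat, \<rho> * real T, 0::real, False)"
  have iter: "(?c ^^ k) ?s = (k + 1, \<rho> * real T - first_pay \<gamma> k, first_gain \<gamma> k, exits \<rho> T k)" for k
    by (induction k) (simp_all add: first_pay_def first_gain_def exits_def Let_def)
  have guard: "?b ((?c ^^ k) ?s) \<longleftrightarrow> continues \<rho> T \<gamma> k" for k
    unfolding iter by (simp add: continues_def Suc_le_eq)
  have "\<exists>k. \<not> ?b ((?c ^^ k) ?s)"
    unfolding guard using not_continues_phase_length by blast
  then have "while ?b ?c ?s = (?c ^^ (LEAST k. \<not> ?b ((?c ^^ k) ?s))) ?s"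
    by (rule while_eq_Least)
  also have "(LEAST k. \<not> ?b ((?c ^^ k) ?s)) = phase_length \<rho> T \<gamma>"
    unfolding guard phase_length_def ..
  finally show ?thesis
    unfolding iter S_first_phase_def by (simp add: Let_def)
qed

lemma S_bids_eq:
  "S_bids \<rho> T \<gamma> t =
    (let K = phase_length \<rho> T \<gamma> in
      if t \<le> K then valuation (\<gamma> t)
      else if exits \<rho> T K then 0
      else A_bids (T - K) (remaining_rate \<rho> T \<gamma> K) (delayed K \<gamma>) (t - K))"
  by (simp add: S_bids_def S_first_phase_eq Let_def remaining_rate_def delayed_def[abs_def])

lemma sum_rounds_split:
  fixes f :: "nat \<Rightarrow> real"
  assumes "k \<le> T"
  shows "(\<Sum>t=1..T. f t) = (\<Sum>i<k. f (Suc i)) + (\<Sum>i<T - k. f (k + Suc i))"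
proof -
  obtain n where T: "T = k + n"
    using assms le_Suc_ex by blast
  show ?thesis
    unfolding T by (induction n) (simp_all add: sum.atLeast1_atMost_eq)
qed

text \<open>Stated for an arbitrary quantity \<open>f\<close> of a round, so that one decomposition
  serves rewards, payments and gains.\<close>

lemma sum_S_bids:
  fixes f :: "request \<Rightarrow> real \<Rightarrow> real" and \<rho> T \<gamma>
  defines "K \<equiv> phase_length \<rho> T \<gamma>"
  shows "(\<Sum>t=1..T. f (\<gamma> t) (S_bids \<rho> T \<gamma> t)) =
    (\<Sum>i<K. f (\<gamma> (Suc i)) (valuation (\<gamma> (Suc i)))) +
    (if exits \<rho> T K then \<Sum>i<T - K. f (\<gamma> (K + Suc i)) 0
     else \<Sum>i<T - K. f (delayed K \<gamma> (Suc i)) (A_bids (T - K) (remaining_rate \<rho> T \<gamma> K) (delayed K \<gamma>) (Suc i)))"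
proof -
  have K: "K \<le> T"
    unfolding K_def by (rule phase_length_le)
  show ?thesis
    unfolding sum_rounds_split[OF K]
    by (simp add: S_bids_eq delayed_def Let_def flip: K_def)
qed

text \<open>Compares the worst deficit of Algorithm A with the threshold of the first phase and
  explains its size: 1 + 2 * sqrt n is at most T^2, whose logarithm is 2 * ln T.\<close>

lemma ln_margin:
  assumes "n < T"
  shows "sqrt (real n) * ln (1 + 2 * sqrt (real n)) \<le> 2 * sqrt (real T) * ln (real T)"
proof (cases "n = 0")
  case False
  then have T: "real n + 1 \<le> real T" "real T \<ge> 2" "real n \<ge> 1"
    using assms by auto
  have "0 \<le> (sqrt (real n) - 1)\<^sup>2"
    by simp
  then have "2 * sqrt (real n) \<le> real n + 1"
    using T by (simp add: power2_diff)
  then have "1 + 2 * sqrt (real n) \<le> 2 * real T"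
    using T by simp
  also have "\<dots> \<le> real T * real T"
    using T by (intro mult_right_mono) auto
  finally have "ln (1 + 2 * sqrt (real n)) \<le> ln (real T * real T)"
    by (intro ln_mono) (auto intro: add_pos_nonneg)
  also have "\<dots> = 2 * ln (real T)"
    using T by (simp add: ln_mult)
  finally have "sqrt (real n) * ln (1 + 2 * sqrt (real n)) \<le> sqrt (real T) * (2 * ln (real T))"
    using T by (intro mult_mono) auto
  then show ?thesis by simp
qed (use assms in simp)

section \<open>Feasibility of Algorithm S\<close>

locale S_run =
  fixes \<rho> :: real and T :: nat and \<gamma> :: "nat \<Rightarrow> request"
  assumes \<rho>: "\<rho> > 0" and T: "T \<ge> 1"
    and truthful: "\<And>t. t \<in> {1..T} \<Longrightarrow> \<gamma> t \<in> truthful_requests"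
begin

definition K :: nat where "K = phase_length \<rho> T \<gamma>"

abbreviation "r \<equiv> remaining_rate \<rho> T \<gamma> K"
abbreviation "n \<equiv> T - K"

lemma K_le: "K \<le> T" and K_pos: "K \<ge> 1"
  using phase_length_le phase_length_pos[OF T] by (auto simp: K_def)

lemma first_pay_bounds: "k \<le> T \<Longrightarrow> 0 \<le> first_pay \<gamma> k" "k \<le> T \<Longrightarrow> first_pay \<gamma> k \<le> k"
proof -
  assume k: "k \<le> T"
  have tr: "\<gamma> (Suc i) \<in> truthful_requests" if "i < k" for i
    using truthful k that by simp
  show "0 \<le> first_pay \<gamma> k"
    unfolding first_pay_def
    by (intro sum_nonneg truthful_bounds valuation_bounds tr) auto
  have "first_pay \<gamma> k \<le> (\<Sum>i<k. 1)"
    unfolding first_pay_def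
    by (intro sum_mono truthful_bounds valuation_bounds tr) auto
  then show "first_pay \<gamma> k \<le> k" by simp
qed

lemma first_gain_nonneg: "k \<le> T \<Longrightarrow> 0 \<le> first_gain \<gamma> k"
  unfolding first_gain_def by (intro sum_nonneg gain_valuation_nonneg truthful) auto

lemma rate_nonneg:
  assumes "\<not> exits \<rho> T K"
  shows "0 \<le> r"
  using assms K_pos first_pay_bounds[OF K_le] by (simp add: exits_def remaining_rate_def)

lemma A_run:
  assumes "\<not> exits \<rho> T K" "K < T"
  shows "A_run n r (delayed K \<gamma>)"
proof
  show "delayed K \<gamma> i \<in> truthful_requests" if "i \<in> {1..n}" for i
    using that assms(2) by (auto simp: delayed_def intro!: truthful)
qed (use assms rate_nonneg in auto)

lemma S_bids_nonneg:
  assumes "t \<in> {1..T}"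
  shows "0 \<le> S_bids \<rho> T \<gamma> t"
proof -
  consider "t \<le> K" | "\<not> t \<le> K" "exits \<rho> T K" | "\<not> t \<le> K" "\<not> exits \<rho> T K"
    by blast
  then show ?thesis
  proof cases
    case 1
    then show ?thesis
      using valuation_bounds(1)[OF truthful[OF assms]] by (simp add: S_bids_eq Let_def flip: K_def)
  next
    case 2
    then show ?thesis by (simp add: S_bids_eq Let_def flip: K_def)
  next
    case 3
    then have "K < T"
      using assms by auto
    then interpret A: A_run n r "delayed K \<gamma>"
      using A_run 3 by blast
    have "t - K = Suc (t - K - 1)" "t - K - 1 < n"
      using 3 assms by auto
    then show ?thesis
      using A.bid_nonneg[of "t - K - 1"] 3 by (simp add: S_bids_eq Let_def flip: K_def)
  qed
qed

lemma RoS: "satisfies_RoS T \<gamma> (S_bids \<rho> T \<gamma>)"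
proof -
  have eq: "reward T \<gamma> (S_bids \<rho> T \<gamma>) - spend T \<gamma> (S_bids \<rho> T \<gamma>) =
      (\<Sum>t=1..T. gain (\<gamma> t) (S_bids \<rho> T \<gamma> t))"
    by (simp add: reward_def spend_def gain_def sum_subtractf)
  have "0 \<le> (\<Sum>t=1..T. gain (\<gamma> t) (S_bids \<rho> T \<gamma> t))"
  proof (cases "exits \<rho> T K \<or> K = T")
    case True
    have "0 \<le> (\<Sum>i<n. gain (\<gamma> (K + Suc i)) 0)"
      by (intro sum_nonneg gain_zero_nonneg truthful) auto
    then show ?thesis
      using True first_gain_nonneg[OF K_le]
      unfolding sum_S_bids K_def[symmetric] first_gain_def[symmetric] by auto
  next
    case False
    then have KT: "K < T" using K_le by simp
    interpret A: A_run n r "delayed K \<gamma>"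
      using A_run False KT by blast
    \<comment> \<open>With requests left and no exit, the loop can only have stopped because the
      gain passed the threshold.\<close>
    have "2 * sqrt (real T) * ln (real T) < first_gain \<gamma> K"
      using not_continues_phase_length[of \<rho> T \<gamma>] False KT by (simp add: continues_def flip: K_def)
    moreover have "sqrt n * ln (1 + 2 * sqrt n) \<le> 2 * sqrt (real T) * ln (real T)"
      using KT K_pos by (intro ln_margin) auto
    ultimately show ?thesis
      using False A.gain_sum_ge
      unfolding sum_S_bids K_def[symmetric] first_gain_def[symmetric] by auto
  qed
  then show ?thesis
    using eq by (simp add: satisfies_RoS_def)
qed

lemma budget:
  assumes "\<rho> * T \<ge> 1"
  shows "satisfies_budget \<rho> T \<gamma> (S_bids \<rho> T \<gamma>)"
proof -
  have "spend T \<gamma> (S_bids \<rho> T \<gamma>) \<le> \<rho> * T"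
  proof (cases "exits \<rho> T K \<or> K = T")
    case True
    \<comment> \<open>The exit test failed after K - 1 rounds, which reads K < \<rho> * T. For K = 1
      there was no earlier test, and the assumption takes its place.\<close>
    have "K \<le> \<rho> * T"
    proof (cases "K = 1")
      case False
      then have "continues \<rho> T \<gamma> (K - 1)" "K - 1 \<ge> 1"
        using K_pos by (auto simp: K_def intro: continues_before)
      then show ?thesis by (auto simp: continues_def exits_def)
    qed (use assms in simp)
    moreover have "(\<Sum>i<n. pay (\<gamma> (K + Suc i)) 0) = 0"
      by (intro sum.neutral ballI pay_zero truthful) auto
    ultimately show ?thesis
      using True first_pay_bounds[OF K_le]
      unfolding spend_def sum_S_bids K_def[symmetric] first_pay_def[symmetric] by auto
  next
    case False
    then have KT: "K < T" using K_le by simp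
    interpret A: A_run n r "delayed K \<gamma>"
      using A_run False KT by blast
    have "r * n = \<rho> * T - first_pay \<gamma> K"
      using KT by (simp add: remaining_rate_def)
    then show ?thesis
      using False A.B_nonneg[of n] A.B_eq[of n]
      unfolding spend_def sum_S_bids K_def[symmetric] first_pay_def[symmetric] by auto
  qed
  then show ?thesis
    by (simp add: satisfies_budget_def)
qed

end

text \<open>The first phase is short enough for the second one to lose little against the full horizon.
  Otherwise \<open>T\<close> is at most a constant times \<open>k + 1\<close>.\<close>

definition short_phase :: "real \<Rightarrow> nat \<Rightarrow> nat \<Rightarrow> bool" where
  "short_phase \<rho> T k \<longleftrightarrow>
     8 \<le> T \<and> 2 * k \<le> T \<and> 2 * real k \<le> \<rho> * real T \<and> real (k + 1) < \<rho> * real T"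

text \<open>Excess of the dual value over its benchmark in round k + i + 1, switched on when the
  first phase has length \<open>k\<close>. The past is read from \<gamma>, and the current request
  is the separate argument \<open>q\<close>, so that it can be averaged with the past held
  fixed.\<close>

definition drift :: "real \<Rightarrow> real \<Rightarrow> nat \<Rightarrow> (nat \<Rightarrow> request) \<Rightarrow> nat \<Rightarrow> nat \<Rightarrow> request \<Rightarrow> real" where
  "drift \<phi> \<rho> T \<gamma> k i q =
    (let r = remaining_rate \<rho> T \<gamma> k in
     case A_state_after (T - k) r (delayed k \<gamma>) i of (l, m, B) \<Rightarrow>
       if phase_length \<rho> T \<gamma> = k \<and> short_phase \<rho> T k \<and> B \<ge> 1
       then dual l m r q - min 1 (r / \<rho>) * \<phi> else 0)"

text \<open>The increments of the stopped martingale in Wald's argument.\<close>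

definition first_drift :: "real \<Rightarrow> real \<Rightarrow> nat \<Rightarrow> (nat \<Rightarrow> request) \<Rightarrow> nat \<Rightarrow> request \<Rightarrow> real" where
  "first_drift \<beta> \<rho> T \<gamma> i q = (if i < phase_length \<rho> T \<gamma> then gain q (valuation q) - \<beta> else 0)"

section \<open>Phase length and regret on a fixed path\<close>

context S_run
begin

text \<open>Wald's argument before taking expectations: the left side is the gain at the stopping
  time, and the last round overshoots the threshold by at most 1.\<close>

lemma first_phase_length_bound:
  fixes \<beta> :: real
  shows "\<beta> * K + (\<Sum>i<T. first_drift \<beta> \<rho> T \<gamma> i (\<gamma> (Suc i))) \<le> 2 * sqrt T * ln T + 1"
proof -
  obtain k where k: "K = Suc k"
    using K_pos by (cases K) auto
  have "(\<Sum>i<T. first_drift \<beta> \<rho> T \<gamma> i (\<gamma> (Suc i))) =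
      (\<Sum>i<K. gain (\<gamma> (Suc i)) (valuation (\<gamma> (Suc i))) - \<beta>)"
    unfolding first_drift_def K_def[symmetric] using K_le
    by (intro sum.mono_neutral_cong_right) auto
  then have "\<beta> * K + (\<Sum>i<T. first_drift \<beta> \<rho> T \<gamma> i (\<gamma> (Suc i))) = first_gain \<gamma> K"
    by (simp add: first_gain_def sum_subtractf)
  also have "\<dots> = first_gain \<gamma> k + gain (\<gamma> (Suc k)) (valuation (\<gamma> (Suc k)))"
    by (simp add: first_gain_def k)
  also have "\<dots> \<le> 2 * sqrt T * ln T + 1"
  proof (intro add_mono gain_bounds valuation_bounds truthful)
    have "continues \<rho> T \<gamma> k"
      using k by (intro continues_before) (simp flip: K_def)
    then show "first_gain \<gamma> k \<le> 2 * sqrt T * ln T"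
      by (simp add: continues_def)
  qed (use K_le k in auto)
  finally show ?thesis .
qed

text \<open>\<phi> will be the expected optimum per round. The terms in K pay for rounds and budget
  consumed by the first phase, those in sqrt T for the loss of Algorithm A.\<close>

lemma regret_pathwise:
  fixes \<phi> :: real
  assumes \<phi>: "0 \<le> \<phi>" "\<phi> \<le> 1"
  shows "T * \<phi> - reward T \<gamma> (S_bids \<rho> T \<gamma>) \<le>
    (2 + 2 / \<rho>) * K + (8 + 2 / \<rho> + 2 / \<rho>\<^sup>2) * sqrt T
    - (\<Sum>k<T. \<Sum>i<T - k. drift \<phi> \<rho> T \<gamma> k i (\<gamma> (k + Suc i)))"
proof -
  let ?X = "\<Sum>k<T. \<Sum>i<T - k. drift \<phi> \<rho> T \<gamma> k i (\<gamma> (k + Suc i))"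
  have sqT: "1 \<le> sqrt T"
    using T by simp
  have X: "?X = (if K < T then \<Sum>i<n. drift \<phi> \<rho> T \<gamma> K i (\<gamma> (K + Suc i)) else 0)"
  proof -
    have "?X = (\<Sum>k<T. if k = K then \<Sum>i<T - k. drift \<phi> \<rho> T \<gamma> k i (\<gamma> (k + Suc i)) else 0)"
    proof (intro sum.cong refl)
      fix k
      show "(\<Sum>i<T - k. drift \<phi> \<rho> T \<gamma> k i (\<gamma> (k + Suc i))) =
          (if k = K then \<Sum>i<T - k. drift \<phi> \<rho> T \<gamma> k i (\<gamma> (k + Suc i)) else 0)"
        by (auto simp: drift_def K_def Let_def split: prod.split intro!: sum.neutral)
    qed
    also have "\<dots> = (if K < T then \<Sum>i<n. drift \<phi> \<rho> T \<gamma> K i (\<gamma> (K + Suc i)) else 0)"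
      by (simp add: sum.delta)
    finally show ?thesis .
  qed
  show ?thesis
  proof (cases "short_phase \<rho> T K")
    case False
    have "?X = 0"
      unfolding X using False by (auto simp: drift_def Let_def split: prod.split intro!: sum.neutral)
    moreover have "0 \<le> reward T \<gamma> (S_bids \<rho> T \<gamma>)"
      by (intro reward_nonneg truthful S_bids_nonneg)
    moreover have "T * \<phi> \<le> T"
      using \<phi> by (simp add: mult_left_le)
    moreover have "real T \<le> (2 + 2 / \<rho>) * K + 8 * sqrt T"
    proof -
      have pos: "0 \<le> 2 / \<rho> * K" "0 \<le> 2 * real K"
        using \<rho> by auto
      \<comment> \<open>The bound K + 1 \<le> 2 * K merges the two budget conditions; T \<le> 8 is
        absorbed by 8 * sqrt T.\<close>
      have "real T \<le> 8 \<or> real T \<le> 2 * real K \<or> \<rho> * real T \<le> 2 * real K"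
        using False K_pos by (auto simp: short_phase_def)
      then have "real T \<le> 8 \<or> real T \<le> 2 * real K \<or> real T \<le> 2 / \<rho> * K"
        using \<rho> by (simp add: field_simps)
      then show ?thesis
        using pos sqT unfolding distrib_right by linarith
    qed
    moreover have "0 \<le> (2 / \<rho> + 2 / \<rho>\<^sup>2) * sqrt T"
      using \<rho> by simp
    moreover have "(8 + 2 / \<rho> + 2 / \<rho>\<^sup>2) * sqrt T = 8 * sqrt T + (2 / \<rho> + 2 / \<rho>\<^sup>2) * sqrt T"
      by (simp add: algebra_simps)
    ultimately show ?thesis
      by linarith
  next
    case True
    then have T8: "T \<ge> 8" and K2: "2 * K \<le> T" and K\<rho>: "2 * real K \<le> \<rho> * T" and ne: "\<not> exits \<rho> T K"
      by (auto simp: short_phase_def exits_def)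
    then have KT: "K < T" by simp
    interpret A: A_run n r "delayed K \<gamma>"
      using A_run ne KT by blast
    define \<kappa> where "\<kappa> = min 1 (r / \<rho>) * \<phi>"
    have n: "real n = real T - real K"
      using KT by simp
    have n0: "0 < real n" "real n \<le> real T"
      using KT by auto
    have rn: "r * n = \<rho> * T - first_pay \<gamma> K"
      using KT by (simp add: remaining_rate_def)
    \<comment> \<open>The first phase pays at most K, which is at most half of the budget.\<close>
    have "\<rho> / 2 * n \<le> \<rho> / 2 * T"
      using n0 \<rho> by (intro mult_left_mono) auto
    also have "\<dots> \<le> r * n"
      using K\<rho> first_pay_bounds(2)[OF K_le] unfolding rn by simp
    finally have r\<rho>: "\<rho> / 2 \<le> r"
      using n0 by (simp add: mult_le_cancel_right)
    then have r0: "r > 0" using \<rho> by simp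
    have \<kappa>: "0 \<le> \<kappa>" "\<kappa> \<le> 1"
      using \<phi> r0 \<rho> by (auto simp: \<kappa>_def intro!: mult_le_one)
    have X': "?X = (\<Sum>i<n. if A.B i \<ge> 1 then dual (A.l i) (A.m i) r (delayed K \<gamma> (Suc i)) - \<kappa> else 0)"
      unfolding X using KT True
      by (simp add: drift_def Let_def A.state_eq delayed_def \<kappa>_def cong: if_cong flip: K_def)
    have n4: "n \<ge> 4"
      using K2 T8 by simp
    have "0 \<le> (\<Sum>i<K. valuation (\<gamma> (Suc i)) * alloc (\<gamma> (Suc i)) (valuation (\<gamma> (Suc i))))"
      using KT by (intro sum_nonneg value_bounds valuation_bounds truthful) auto
    then have "?X + n * \<kappa> - (7 * sqrt n + 1 / r + (1 + 1 / r\<^sup>2) * sqrt n / 2)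
        \<le> reward T \<gamma> (S_bids \<rho> T \<gamma>)"
      using A.reward_ge[OF n4 r0 \<kappa>] ne
      unfolding X' reward_def sum_S_bids[where f="\<lambda>q b. valuation q * alloc q b"] K_def[symmetric]
      by simp
    moreover have "T * \<phi> - n * \<kappa> \<le> (2 + 2 / \<rho>) * K"
    proof -
      \<comment> \<open>If the rate has dropped, n * r is the remaining budget and the loss is the
        first-phase payment over \<rho>; otherwise only the K rounds are lost.\<close>
      have "T * \<phi> - (1 + 1 / \<rho>) * K \<le> n * \<kappa>"
      proof (cases "r / \<rho> \<le> 1")
        case True
        then have "n * \<kappa> = (\<rho> * T - first_pay \<gamma> K) / \<rho> * \<phi>"
          by (simp add: \<kappa>_def min_def mult.commute flip: rn)
        also have "\<dots> = T * \<phi> - first_pay \<gamma> K / \<rho> * \<phi>"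
          using \<rho> by (simp add: field_simps)
        finally have "n * \<kappa> = T * \<phi> - first_pay \<gamma> K / \<rho> * \<phi>" .
        moreover have "first_pay \<gamma> K / \<rho> * \<phi> \<le> K / \<rho> * 1"
          using first_pay_bounds[OF K_le] \<rho> \<phi> by (intro mult_mono divide_right_mono) auto
        ultimately show ?thesis
          by (simp add: algebra_simps)
      next
        case False
        then have "n * \<kappa> = T * \<phi> - K * \<phi>"
          by (simp add: \<kappa>_def n algebra_simps)
        moreover have "K * \<phi> \<le> K" "0 \<le> K / \<rho>"
          using \<phi> \<rho> by (auto simp: mult_left_le)
        ultimately show ?thesis
          by (simp add: algebra_simps)
      qed
      moreover have "(1 + 1 / \<rho>) * K \<le> (2 + 2 / \<rho>) * K"
        using \<rho> by (intro mult_right_mono add_mono divide_right_mono) auto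
      ultimately show ?thesis by linarith
    qed
    moreover have "7 * sqrt n + 1 / r + (1 + 1 / r\<^sup>2) * sqrt n / 2 \<le> (8 + 2 / \<rho> + 2 / \<rho>\<^sup>2) * sqrt T"
    proof -
      have "1 / r \<le> 1 / (\<rho> / 2)"
        using r\<rho> \<rho> by (intro divide_left_mono) auto
      then have r1: "1 / r \<le> 2 / \<rho>" by simp
      then have "(1 / r)\<^sup>2 \<le> (2 / \<rho>)\<^sup>2"
        using r0 by (intro power_mono) auto
      then have r2: "1 / r\<^sup>2 \<le> 4 / \<rho>\<^sup>2"
        by (simp add: power_divide)
      have nT: "sqrt n \<le> sqrt T" using n0 by simp
      have "7 * sqrt n + 1 / r + (1 + 1 / r\<^sup>2) * sqrt n / 2 \<le>
          7 * sqrt T + 2 / \<rho> * sqrt T + (1 + 4 / \<rho>\<^sup>2) * sqrt T / 2"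
      proof (intro add_mono divide_right_mono mult_mono)
        have "2 / \<rho> * 1 \<le> 2 / \<rho> * sqrt T"
          using sqT \<rho> by (intro mult_left_mono) auto
        then show "1 / r \<le> 2 / \<rho> * sqrt T" using r1 by simp
      qed (use nT r2 in auto)
      also have "\<dots> \<le> (8 + 2 / \<rho> + 2 / \<rho>\<^sup>2) * sqrt T"
        by (simp add: algebra_simps)
      finally show ?thesis .
    qed
    ultimately show ?thesis by linarith
  qed
qed

end


section \<open>Measurability\<close>

text \<open>Projections replace pattern matching, so that \<open>measurable\<close> can decompose
  the state.\<close>

lemma A_bid_in_eq:
  "A_bid_in s v =
    (if 1 \<le> snd (snd s) then (1 + fst s) / (fst (snd s) + fst s) * v else 0)"
  by (cases s rule: prod_cases3) simp

lemma A_update_eq: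
  "A_update n r q s =
    (let b = A_bid_in s (valuation q) in
      (fst s * exp (- (1 / sqrt (real n)) * gain q b),
       max 0 (fst (snd s) - 1 / ((1 + r\<^sup>2) * sqrt (real n)) * (r - pay q b)),
       snd (snd s) - pay q b))"
  by (cases s rule: prod_cases3) (simp add: Let_def)

lemma A_bids_nonneg:
  assumes "\<gamma> t \<in> truthful_requests"
  shows "0 \<le> A_bids n r \<gamma> t"
  using A_state_positive[of n r \<gamma> "t - 1"] valuation_bounds(1)[OF assms]
  by (auto simp: A_bids_def A_bid_in_eq)

locale requests =
  fixes P :: "request measure"
  assumes distribution: "request_distribution P"
begin

lemma prob_space_P: "prob_space P"
  and space_P: "space P \<subseteq> truthful_requests"
  and valuation_measurable [measurable]: "valuation \<in> borel_measurable P"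
  and alloc_joint: "(\<lambda>(b, q). alloc q b) \<in> borel_measurable (restrict_space borel {0..} \<Otimes>\<^sub>M P)"
  using distribution by (auto simp: request_distribution_def)

lemma truthful: "q \<in> space P \<Longrightarrow> q \<in> truthful_requests"
  using space_P by blast

lemma alloc_measurable:
  assumes Q: "Q \<in> N \<rightarrow>\<^sub>M P" and f: "f \<in> borel_measurable N"
    and nonneg: "\<And>x. x \<in> space N \<Longrightarrow> 0 \<le> f x"
  shows "(\<lambda>x. alloc (Q x) (f x)) \<in> borel_measurable N"
proof -
  have "f \<in> N \<rightarrow>\<^sub>M restrict_space borel {0..}"
    by (rule measurable_restrict_space2) (use nonneg f in auto)
  then have "(\<lambda>x. (f x, Q x)) \<in> N \<rightarrow>\<^sub>M restrict_space borel {0..} \<Otimes>\<^sub>M P"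
    using Q by (rule measurable_Pair)
  from measurable_compose[OF this alloc_joint] show ?thesis by simp
qed

text \<open>The payment formula contains an integral with a random endpoint. Moving the endpoint
  into the integrand as a condition makes it a parametrised Lebesgue integral over a fixed
  domain.\<close>

lemma pay_measurable:
  assumes Q: "Q \<in> N \<rightarrow>\<^sub>M P" and f: "f \<in> borel_measurable N"
    and nonneg: "\<And>x. x \<in> space N \<Longrightarrow> 0 \<le> f x"
  shows "(\<lambda>x. pay (Q x) (f x)) \<in> borel_measurable N"
proof -
  note [measurable] = Q f
  have [measurable]: "(\<lambda>x. alloc (Q x) (f x)) \<in> borel_measurable N"
    using Q f nonneg by (rule alloc_measurable)
  have [measurable]: "(\<lambda>y. alloc (Q (fst y)) (max 0 (snd y))) \<in> borel_measurable (N \<Otimes>\<^sub>M lborel)"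
    by (rule alloc_measurable) auto
  have "(\<lambda>y. if 0 \<le> snd y \<and> snd y \<le> f (fst y) then alloc (Q (fst y)) (max 0 (snd y)) else 0)
      \<in> borel_measurable (N \<Otimes>\<^sub>M lborel)"
    by measurable
  then have "(\<lambda>x. LINT z|lborel. (if 0 \<le> z \<and> z \<le> f x then alloc (Q x) (max 0 z) else 0))
      \<in> borel_measurable N"
    by (intro lborel.borel_measurable_lebesgue_integral) (simp add: case_prod_unfold)
  then have "(\<lambda>x. f x * alloc (Q x) (f x) -
      (LINT z|lborel. (if 0 \<le> z \<and> z \<le> f x then alloc (Q x) (max 0 z) else 0))) \<in> borel_measurable N"
    by measurable
  also have "?this \<longleftrightarrow> ?thesis"
  proof (rule measurable_cong)
    fix x assume x: "x \<in> space N"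
    have q: "Q x \<in> truthful_requests"
      by (intro truthful measurable_space[OF Q x])
    have "(LINT z|lborel. (if 0 \<le> z \<and> z \<le> f x then alloc (Q x) (max 0 z) else 0)) =
        (LINT z:{0..f x}|lborel. alloc (Q x) z)"
      unfolding set_lebesgue_integral_def
      by (intro Bochner_Integration.integral_cong) (auto simp: indicator_def)
    also have "\<dots> = integral {0..f x} (alloc (Q x))"
      by (rule set_borel_integral_eq_integral[OF set_integrable_alloc[OF q]])
    finally show "f x * alloc (Q x) (f x) -
        (LINT z|lborel. (if 0 \<le> z \<and> z \<le> f x then alloc (Q x) (max 0 z) else 0)) = pay (Q x) (f x)"
      using q nonneg[OF x] unfolding truthful_requests_def by force
  qed
  finally show ?thesis .
qed

lemma valuation_comp_measurable:
  "Q \<in> N \<rightarrow>\<^sub>M P \<Longrightarrow> (\<lambda>x. valuation (Q x)) \<in> borel_measurable N"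
  by (rule measurable_compose[OF _ valuation_measurable])

lemma gain_measurable:
  assumes "Q \<in> N \<rightarrow>\<^sub>M P" "f \<in> borel_measurable N" "\<And>x. x \<in> space N \<Longrightarrow> 0 \<le> f x"
  shows "(\<lambda>x. gain (Q x) (f x)) \<in> borel_measurable N"
  unfolding gain_def
  using valuation_comp_measurable[OF assms(1)] alloc_measurable[OF assms] pay_measurable[OF assms]
  by measurable

lemma valuation_comp_nonneg:
  "Q \<in> N \<rightarrow>\<^sub>M P \<Longrightarrow> x \<in> space N \<Longrightarrow> 0 \<le> valuation (Q x)"
  by (intro valuation_bounds truthful) (rule measurable_space)

lemma dual_measurable:
  assumes [measurable]: "Q \<in> N \<rightarrow>\<^sub>M P" "l \<in> borel_measurable N" "m \<in> borel_measurable N"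
      "r \<in> borel_measurable N"
    and pos: "\<And>x. x \<in> space N \<Longrightarrow> 0 < l x" "\<And>x. x \<in> space N \<Longrightarrow> 0 \<le> m x"
  shows "(\<lambda>x. dual (l x) (m x) (r x) (Q x)) \<in> borel_measurable N"
proof -
  have [measurable]: "(\<lambda>x. valuation (Q x)) \<in> borel_measurable N"
    by (rule valuation_comp_measurable) fact
  have b: "(\<lambda>x. dual_bid (l x) (m x) (Q x)) \<in> borel_measurable N"
    unfolding dual_bid_def by measurable
  have b0: "0 \<le> dual_bid (l x) (m x) (Q x)" if "x \<in> space N" for x
    using that by (intro dual_bid_nonneg pos truthful) (rule measurable_space[OF assms(1)])
  show ?thesis
    unfolding dual_def lagrangian_def
    by (intro borel_measurable_add borel_measurable_times borel_measurable_diff alloc_measurable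
        pay_measurable gain_measurable valuation_comp_measurable assms b b0)
qed

text \<open>The rate is random, as it depends on the first phase. Only rounds up to \<open>k\<close>
  are required to be measurable, since a delayed sequence runs past the index set of the
  product.\<close>

lemma A_state_measurable:
  assumes r [measurable]: "r \<in> borel_measurable N"
    and Q: "\<And>i. i \<in> {1..k} \<Longrightarrow> (\<lambda>x. Q x i) \<in> N \<rightarrow>\<^sub>M P"
  shows "(\<lambda>x. A_state_after n (r x) (Q x) k) \<in> N \<rightarrow>\<^sub>M borel \<Otimes>\<^sub>M borel \<Otimes>\<^sub>M borel"
  using Q
proof (induction k)
  case (Suc k)
  let ?s = "\<lambda>x. A_state_after n (r x) (Q x) k"
  have [measurable]: "?s \<in> N \<rightarrow>\<^sub>M borel \<Otimes>\<^sub>M borel \<Otimes>\<^sub>M borel"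
    using Suc by auto
  have q [measurable]: "(\<lambda>x. Q x (Suc k)) \<in> N \<rightarrow>\<^sub>M P"
    using Suc.prems by auto
  have [measurable]: "(\<lambda>x. valuation (Q x (Suc k))) \<in> borel_measurable N"
    by (rule valuation_comp_measurable) fact
  have b: "(\<lambda>x. A_bid_in (?s x) (valuation (Q x (Suc k)))) \<in> borel_measurable N"
    unfolding A_bid_in_eq by measurable
  have b0: "0 \<le> A_bid_in (?s x) (valuation (Q x (Suc k)))" if "x \<in> space N" for x
    using A_state_positive[of n "r x" "Q x" k] valuation_comp_nonneg[OF q that]
    by (auto simp: A_bid_in_eq)
  have [measurable]: "(\<lambda>x. pay (Q x (Suc k)) (A_bid_in (?s x) (valuation (Q x (Suc k))))) \<in> borel_measurable N"
    "(\<lambda>x. gain (Q x (Suc k)) (A_bid_in (?s x) (valuation (Q x (Suc k))))) \<in> borel_measurable N"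
    by (intro pay_measurable gain_measurable q b b0; assumption)+
  show ?case
    unfolding A_state_after.simps A_update_eq Let_def by measurable
qed simp

lemma A_bids_measurable:
  assumes r: "r \<in> borel_measurable N"
    and Q: "\<And>i. i \<in> {1..k} \<Longrightarrow> (\<lambda>x. Q x i) \<in> N \<rightarrow>\<^sub>M P" and k: "k \<ge> 1"
  shows "(\<lambda>x. A_bids n (r x) (Q x) k) \<in> borel_measurable N"
proof -
  have [measurable]: "(\<lambda>x. A_state_after n (r x) (Q x) (k - 1)) \<in> N \<rightarrow>\<^sub>M borel \<Otimes>\<^sub>M borel \<Otimes>\<^sub>M borel"
    using Q by (intro A_state_measurable r) auto
  have [measurable]: "(\<lambda>x. valuation (Q x k)) \<in> borel_measurable N"
    by (rule valuation_comp_measurable) (use Q k in auto)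
  show ?thesis
    unfolding A_bids_def A_bid_in_eq by measurable
qed

end

section \<open>Random variables on the product of T independent requests\<close>

locale iid = requests P for P +
  fixes T :: nat and \<rho> :: real
  assumes T: "T \<ge> 1" and \<rho>: "\<rho> > 0"
begin

abbreviation "M \<equiv> iid_requests T P"

sublocale req: prob_space P
  by (rule prob_space_P)

lemma prob_space_M: "prob_space M"
  unfolding iid_requests_def by (intro prob_space_PiM req.prob_space_axioms)

sublocale M: prob_space M
  by (rule prob_space_M)

lemma component_measurable: "t \<in> {1..T} \<Longrightarrow> (\<lambda>\<gamma>. \<gamma> t) \<in> M \<rightarrow>\<^sub>M P"
  unfolding iid_requests_def by (rule measurable_component_singleton)

lemma component_space: "\<gamma> \<in> space M \<Longrightarrow> t \<in> {1..T} \<Longrightarrow> \<gamma> t \<in> space P"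
  by (rule measurable_space[OF component_measurable])

lemma component_truthful: "\<gamma> \<in> space M \<Longrightarrow> t \<in> {1..T} \<Longrightarrow> \<gamma> t \<in> truthful_requests"
  by (intro truthful component_space)

lemma S_run: "\<gamma> \<in> space M \<Longrightarrow> S_run \<rho> T \<gamma>"
  by unfold_locales (use \<rho> T component_truthful in auto)

lemma first_gain_measurable:
  assumes "k \<le> T"
  shows "(\<lambda>\<gamma>. first_gain \<gamma> k) \<in> borel_measurable M"
  unfolding first_gain_def using assms
  by (intro borel_measurable_sum gain_measurable component_measurable valuation_comp_measurable
      valuation_comp_nonneg[where N=M]) auto

lemma first_pay_measurable:
  assumes "k \<le> T"
  shows "(\<lambda>\<gamma>. first_pay \<gamma> k) \<in> borel_measurable M"
  unfolding first_pay_def using assms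
  by (intro borel_measurable_sum pay_measurable component_measurable valuation_comp_measurable
      valuation_comp_nonneg[where N=M]) auto

lemma continues_measurable:
  assumes "k \<le> T"
  shows "Measurable.pred M (\<lambda>\<gamma>. continues \<rho> T \<gamma> k)"
proof -
  note [measurable] = first_gain_measurable[OF assms]
  have "Measurable.pred M (\<lambda>\<gamma>. first_gain \<gamma> k \<le> 2 * sqrt (real T) * ln (real T))"
    by measurable
  then show ?thesis
    unfolding continues_def by (intro pred_intros_conj1')
qed

lemma phase_length_measurable:
  assumes "k \<le> T"
  shows "Measurable.pred M (\<lambda>\<gamma>. phase_length \<rho> T \<gamma> = k)"
    and "Measurable.pred M (\<lambda>\<gamma>. k < phase_length \<rho> T \<gamma>)"
proof -
  have all: "Measurable.pred M (\<lambda>\<gamma>. \<forall>j\<in>J. continues \<rho> T \<gamma> j)" if "J \<subseteq> {..k}" for J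
    by (intro pred_intros_finite continues_measurable)
      (use assms that finite_subset[OF that] in auto)
  have "phase_length \<rho> T \<gamma> = k \<longleftrightarrow> (\<forall>j\<in>{..<k}. continues \<rho> T \<gamma> j) \<and> \<not> continues \<rho> T \<gamma> k" for \<gamma>
    by (simp add: phase_length_eq_iff Ball_def)
  then show "Measurable.pred M (\<lambda>\<gamma>. phase_length \<rho> T \<gamma> = k)"
    by (simp only:) (intro pred_intros_logic(2,3) all continues_measurable assms, auto)
  have "k < phase_length \<rho> T \<gamma> \<longleftrightarrow> (\<forall>j\<in>{..k}. continues \<rho> T \<gamma> j)" for \<gamma>
    by (simp add: less_phase_length_iff Ball_def)
  then show "Measurable.pred M (\<lambda>\<gamma>. k < phase_length \<rho> T \<gamma>)"
    by (simp only:) (intro all, auto)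
qed

lemma remaining_rate_measurable:
  assumes "k \<le> T"
  shows "(\<lambda>\<gamma>. remaining_rate \<rho> T \<gamma> k) \<in> borel_measurable M"
proof -
  note [measurable] = first_pay_measurable[OF assms]
  show ?thesis unfolding remaining_rate_def by measurable
qed

lemma delayed_measurable: "i \<in> {1..T - k} \<Longrightarrow> (\<lambda>\<gamma>. delayed k \<gamma> i) \<in> M \<rightarrow>\<^sub>M P"
  unfolding delayed_def by (rule component_measurable) auto

text \<open>Splitting over the finitely many values of the phase length gives Algorithm A a fixed
  horizon and fixed round indices in each piece.\<close>

lemma reward_S_measurable: "(\<lambda>\<gamma>. reward T \<gamma> (S_bids \<rho> T \<gamma>)) \<in> borel_measurable M"
proof -
  let ?f = "\<lambda>q b. valuation q * alloc q b"
  let ?R = "\<lambda>\<gamma> k. (\<Sum>i<k. ?f (\<gamma> (Suc i)) (valuation (\<gamma> (Suc i)))) +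
    (if exits \<rho> T k then \<Sum>i<T - k. ?f (\<gamma> (k + Suc i)) 0
     else \<Sum>i<T - k. ?f (delayed k \<gamma> (Suc i))
       (A_bids (T - k) (remaining_rate \<rho> T \<gamma> k) (delayed k \<gamma>) (Suc i)))"
  have val: "(\<lambda>\<gamma>. ?f (Q \<gamma>) (b \<gamma>)) \<in> borel_measurable M"
    if "Q \<in> M \<rightarrow>\<^sub>M P" "b \<in> borel_measurable M" "\<And>\<gamma>. \<gamma> \<in> space M \<Longrightarrow> 0 \<le> b \<gamma>" for Q b
    using alloc_measurable[OF that] valuation_comp_measurable[OF that(1)] by measurable
  have R: "(\<lambda>\<gamma>. ?R \<gamma> k) \<in> borel_measurable M" if k: "k \<le> T" for k
  proof (intro borel_measurable_add borel_measurable_sum val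
      component_measurable valuation_comp_measurable)
    show "0 \<le> valuation (\<gamma> (Suc i))" if "\<gamma> \<in> space M" "i \<in> {..<k}" for \<gamma> i
      using component_truthful[OF that(1), of "Suc i"] that k valuation_bounds(1) by auto
    have "(\<lambda>\<gamma>. \<Sum>i<T - k. ?f (\<gamma> (k + Suc i)) 0) \<in> borel_measurable M"
      by (intro borel_measurable_sum val component_measurable) auto
    moreover have "(\<lambda>\<gamma>. \<Sum>i<T - k. ?f (delayed k \<gamma> (Suc i))
       (A_bids (T - k) (remaining_rate \<rho> T \<gamma> k) (delayed k \<gamma>) (Suc i))) \<in> borel_measurable M"
    proof (intro borel_measurable_sum val delayed_measurable A_bids_measurable
        remaining_rate_measurable k)
      show "0 \<le> A_bids (T - k) (remaining_rate \<rho> T \<gamma> k) (delayed k \<gamma>) (Suc i)"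
        if "\<gamma> \<in> space M" "i \<in> {..<T - k}" for \<gamma> i
        using that by (intro A_bids_nonneg) (auto simp: delayed_def intro!: component_truthful)
    qed auto
    ultimately show "(\<lambda>\<gamma>. if exits \<rho> T k then \<Sum>i<T - k. ?f (\<gamma> (k + Suc i)) 0
      else \<Sum>i<T - k. ?f (delayed k \<gamma> (Suc i))
       (A_bids (T - k) (remaining_rate \<rho> T \<gamma> k) (delayed k \<gamma>) (Suc i))) \<in> borel_measurable M"
      by (cases "exits \<rho> T k") (simp_all only: if_True if_False)
  qed (use k in auto)
  have "(\<lambda>\<gamma>. \<Sum>k\<le>T. if phase_length \<rho> T \<gamma> = k then ?R \<gamma> k else 0) \<in> borel_measurable M"
  proof (intro borel_measurable_sum)
    fix k assume "k \<in> {..T}"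
    then have k: "k \<le> T" by simp
    show "(\<lambda>\<gamma>. if phase_length \<rho> T \<gamma> = k then ?R \<gamma> k else 0) \<in> borel_measurable M"
      by (intro measurable_If R k borel_measurable_const phase_length_measurable(1)[unfolded pred_def])
  qed
  moreover have "reward T \<gamma> (S_bids \<rho> T \<gamma>) =
      (\<Sum>k\<le>T. if phase_length \<rho> T \<gamma> = k then ?R \<gamma> k else 0)" for \<gamma>
    using phase_length_le[of \<rho> T \<gamma>] unfolding reward_def sum_S_bids[where f="?f"]
    by (simp add: sum.delta)
  ultimately show ?thesis by simp
qed

end


section \<open>Conditional drifts\<close>

lemma A_state_cong:
  assumes "\<And>i. i \<in> {1..k} \<Longrightarrow> \<gamma> i = \<gamma>' i"
  shows "A_state_after n r \<gamma> k = A_state_after n r \<gamma>' k"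
  using assms by (induction k) auto

text \<open>Predictability: the coefficients for round k + i + 1 are settled by the k + i requests
  before it.\<close>

lemma drift_cong:
  assumes "\<And>t. t \<in> {1..k + i} \<Longrightarrow> \<gamma> t = \<gamma>' t"
  shows "drift \<phi> \<rho> T \<gamma> k i q = drift \<phi> \<rho> T \<gamma>' k i q"
proof -
  have gain: "first_gain \<gamma> j = first_gain \<gamma>' j" if "j \<le> k" for j
    unfolding first_gain_def using that assms by (intro sum.cong) auto
  have pay: "first_pay \<gamma> k = first_pay \<gamma>' k"
    unfolding first_pay_def using assms by (intro sum.cong) auto
  have "phase_length \<rho> T \<gamma> = k \<longleftrightarrow> phase_length \<rho> T \<gamma>' = k"
    unfolding phase_length_eq_iff continues_def using gain by auto
  moreover have "remaining_rate \<rho> T \<gamma> k = remaining_rate \<rho> T \<gamma>' k"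
    by (simp add: remaining_rate_def pay)
  moreover have "A_state_after n r (delayed k \<gamma>) i = A_state_after n r (delayed k \<gamma>') i" for n r
    by (rule A_state_cong) (auto simp: delayed_def intro!: assms)
  ultimately show ?thesis
    by (simp add: drift_def)
qed

lemma first_drift_cong:
  assumes "\<And>t. t \<in> {1..i} \<Longrightarrow> \<gamma> t = \<gamma>' t"
  shows "first_drift \<beta> \<rho> T \<gamma> i q = first_drift \<beta> \<rho> T \<gamma>' i q"
proof -
  have "first_gain \<gamma> j = first_gain \<gamma>' j" if "j \<le> i" for j
    unfolding first_gain_def using that assms by (intro sum.cong) auto
  then show ?thesis
    by (simp add: first_drift_def less_phase_length_iff continues_def)
qed

context iid
begin

lemma integrable_bounded:
  fixes f :: "(nat \<Rightarrow> request) \<Rightarrow> real"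
  assumes "f \<in> borel_measurable M" "\<And>\<gamma>. \<gamma> \<in> space M \<Longrightarrow> \<bar>f \<gamma>\<bar> \<le> C"
  shows "integrable M f"
  by (rule M.integrable_const_bound[where B=C]) (use assms in auto)

text \<open>The coefficients of \<open>f\<close> are chosen before round \<open>t\<close>, so that request can be integrated out
  first.\<close>

lemma predictable_integral_nonneg:
  fixes f :: "(nat \<Rightarrow> request) \<Rightarrow> request \<Rightarrow> real"
  assumes t: "t \<in> {1..T}"
    and int: "integrable M (\<lambda>\<gamma>. f \<gamma> (\<gamma> t))"
    and predictable: "\<And>\<gamma> y q. f (\<gamma>(t := y)) q = f \<gamma> q"
    and mean: "\<And>\<gamma>. \<gamma> \<in> space M \<Longrightarrow> 0 \<le> (LINT q|P. f \<gamma> q)"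
  shows "0 \<le> (LINT \<gamma>|M. f \<gamma> (\<gamma> t))"
proof -
  interpret product_sigma_finite "\<lambda>_::nat. P"
    by unfold_locales
  let ?I = "{1..T} - {t}"
  have "{1..T} = insert t ?I"
    using t by auto
  then have M_eq: "M = Pi\<^sub>M (insert t ?I) (\<lambda>_. P)"
    by (simp only: iid_requests_def)
  have "(LINT \<gamma>|M. f \<gamma> (\<gamma> t)) = (LINT \<gamma>|Pi\<^sub>M ?I (\<lambda>_. P). LINT y|P. f (\<gamma>(t := y)) ((\<gamma>(t := y)) t))"
    unfolding M_eq by (rule product_integral_insert[OF _ _ int[unfolded M_eq]]) auto
  \<comment> \<open>no\<close>
  also have "\<dots> = (LINT \<gamma>|Pi\<^sub>M ?I (\<lambda>_. P). LINT y|P. f \<gamma> y)"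
    by (simp add: predictable)
  also have "0 \<le> \<dots>"
  proof (rule Bochner_Integration.integral_nonneg)
    fix \<gamma> assume \<gamma>: "\<gamma> \<in> space (Pi\<^sub>M ?I (\<lambda>_. P))"
    obtain y where "y \<in> space P"
      using req.not_empty by blast
    then have "\<gamma>(t := y) \<in> space M"
      using \<gamma> t by (auto simp: iid_requests_def space_PiM PiE_iff extensional_def)
    from mean[OF this] show "0 \<le> (LINT y|P. f \<gamma> y)"
      by (simp add: predictable)
  qed
  finally show ?thesis .
qed

lemma dual_integrable:
  assumes "l > 0" "m \<ge> 0"
  shows "integrable P (dual l m r)"
proof (rule req.integrable_const_bound[where B="1 + l + \<bar>m * r\<bar>"])
  have "(\<lambda>q. dual l m r q) \<in> borel_measurable P"
    by (intro dual_measurable[where Q="\<lambda>q. q"]) (use assms in auto)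
  then show "dual l m r \<in> borel_measurable P" by simp
  show "AE q in P. norm (dual l m r q) \<le> 1 + l + \<bar>m * r\<bar>"
  proof (rule AE_I2)
    fix q assume "q \<in> space P"
    from dual_bounds[OF truthful[OF this] assms, of r]
    show "norm (dual l m r q) \<le> 1 + l + \<bar>m * r\<bar>"
      using assms by auto
  qed
qed

lemma component_integral:
  fixes f :: "request \<Rightarrow> real"
  assumes "t \<in> {1..T}" "f \<in> borel_measurable P"
  shows "(LINT \<gamma>|M. f (\<gamma> t)) = (LINT q|P. f q)"
proof -
  have d: "distr M P (\<lambda>\<gamma>. \<gamma> t) = P"
    unfolding iid_requests_def by (rule distr_PiM_component) (use assms req.prob_space_axioms in auto)
  show ?thesis
    using integral_distr[OF component_measurable[OF assms(1)] assms(2)] by (simp add: d)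
qed

lemma truthful_gain_integrable: "integrable P (\<lambda>q. gain q (valuation q))"
  and truthful_gain_integral: "(LINT q|P. gain q (valuation q)) = expected_truthful_gain P"
proof -
  show "integrable P (\<lambda>q. gain q (valuation q))"
  proof (rule req.integrable_const_bound[where B=1])
    show "(\<lambda>q. gain q (valuation q)) \<in> borel_measurable P"
      by (rule gain_measurable[where Q="\<lambda>q. q"]) (auto intro!: valuation_bounds truthful)
    show "AE q in P. norm (gain q (valuation q)) \<le> 1"
      using gain_bounds[OF truthful valuation_bounds(1)[OF truthful]]
      by (intro AE_I2) (auto simp: abs_le_iff minus_le_iff)
  qed
  show "(LINT q|P. gain q (valuation q)) = expected_truthful_gain P"
    unfolding expected_truthful_gain_def
    by (rule Bochner_Integration.integral_cong) (auto simp: gain_valuation_nonneg truthful)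
qed

lemma first_drift:
  assumes "i < T"
  shows "integrable M (\<lambda>\<gamma>. first_drift (expected_truthful_gain P) \<rho> T \<gamma> i (\<gamma> (Suc i)))" (is ?int)
    and "0 \<le> (LINT \<gamma>|M. first_drift (expected_truthful_gain P) \<rho> T \<gamma> i (\<gamma> (Suc i)))"
proof -
  let ?\<beta> = "expected_truthful_gain P"
  have t: "Suc i \<in> {1..T}" using assms by simp
  have tr: "\<gamma> (Suc i) \<in> truthful_requests" if "\<gamma> \<in> space M" for \<gamma>
    using that t by (rule component_truthful)
  have "(\<lambda>\<gamma>. gain (\<gamma> (Suc i)) (valuation (\<gamma> (Suc i)))) \<in> borel_measurable M"
    by (intro gain_measurable valuation_comp_measurable component_measurable t valuation_bounds tr)
  then have "(\<lambda>\<gamma>. first_drift ?\<beta> \<rho> T \<gamma> i (\<gamma> (Suc i))) \<in> borel_measurable M"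
    unfolding first_drift_def using assms
    by (intro measurable_If borel_measurable_const borel_measurable_diff
        phase_length_measurable(2)[unfolded pred_def]) auto
  then show int: ?int
  proof (rule integrable_bounded)
    fix \<gamma> assume "\<gamma> \<in> space M"
    from gain_bounds[OF tr[OF this] valuation_bounds(1)[OF tr[OF this]]]
    show "\<bar>first_drift ?\<beta> \<rho> T \<gamma> i (\<gamma> (Suc i))\<bar> \<le> 1 + \<bar>?\<beta>\<bar>"
      by (auto simp: first_drift_def)
  qed
  have mean: "0 \<le> (LINT q|P. first_drift ?\<beta> \<rho> T \<gamma> i q)" for \<gamma>
  proof (cases "i < phase_length \<rho> T \<gamma>")
    case True
    then show ?thesis
      using truthful_gain_integrable
      by (simp add: first_drift_def truthful_gain_integral req.prob_space)
  qed (simp add: first_drift_def)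
  show "0 \<le> (LINT \<gamma>|M. first_drift ?\<beta> \<rho> T \<gamma> i (\<gamma> (Suc i)))"
    using t int by (rule predictable_integral_nonneg) (auto intro!: first_drift_cong mean)
qed

lemma drift:
  assumes k: "k < T" and i: "i < T - k" and \<phi>: "0 \<le> \<phi>" "\<phi> \<le> 1"
    and dual: "\<And>l m. l > 0 \<Longrightarrow> m \<ge> 0 \<Longrightarrow> \<phi> \<le> (LINT q|P. dual l m \<rho> q)"
  shows "integrable M (\<lambda>\<gamma>. drift \<phi> \<rho> T \<gamma> k i (\<gamma> (k + Suc i)))" (is ?int)
    and "0 \<le> (LINT \<gamma>|M. drift \<phi> \<rho> T \<gamma> k i (\<gamma> (k + Suc i)))"
proof -
  let ?r = "\<lambda>\<gamma>. remaining_rate \<rho> T \<gamma> k"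
  let ?s = "\<lambda>\<gamma>. A_state_after (T - k) (?r \<gamma>) (delayed k \<gamma>) i"
  let ?c = "\<lambda>\<gamma>. phase_length \<rho> T \<gamma> = k \<and> short_phase \<rho> T k \<and> 1 \<le> snd (snd (?s \<gamma>))"
  have t: "k + Suc i \<in> {1..T}"
    using i by simp
  have drift_eq: "drift \<phi> \<rho> T \<gamma> k i q =
      (if ?c \<gamma> then dual (fst (?s \<gamma>)) (fst (snd (?s \<gamma>))) (?r \<gamma>) q - min 1 (?r \<gamma> / \<rho>) * \<phi> else 0)"
    for \<gamma> q
    unfolding drift_def Let_def by (cases "?s \<gamma>") simp
  have pos: "0 < fst (?s \<gamma>)" "0 \<le> fst (snd (?s \<gamma>))" for \<gamma>
    using A_state_positive by auto
  have r0: "0 \<le> ?r \<gamma>" "?r \<gamma> \<le> \<rho> * T" if "?c \<gamma>" "\<gamma> \<in> space M" for \<gamma>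
  proof -
    have "0 \<le> first_pay \<gamma> k" "first_pay \<gamma> k \<le> k"
      using S_run.first_pay_bounds[OF S_run[OF that(2)]] k by auto
    then have *: "0 \<le> \<rho> * T - first_pay \<gamma> k" "\<rho> * T - first_pay \<gamma> k \<le> \<rho> * T"
      using that(1) by (auto simp: short_phase_def)
    then show "0 \<le> ?r \<gamma>"
      by (simp add: remaining_rate_def)
    have "?r \<gamma> \<le> (\<rho> * T - first_pay \<gamma> k) / 1"
      unfolding remaining_rate_def using * k by (intro divide_left_mono) auto
    then show "?r \<gamma> \<le> \<rho> * T" using * by simp
  qed
  have r [measurable]: "?r \<in> borel_measurable M"
    by (rule remaining_rate_measurable) (use k in simp)
  have s [measurable]: "?s \<in> M \<rightarrow>\<^sub>M borel \<Otimes>\<^sub>M borel \<Otimes>\<^sub>M borel"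
    by (intro A_state_measurable r delayed_measurable) (use i in auto)
  have meas: "(\<lambda>\<gamma>. drift \<phi> \<rho> T \<gamma> k i (\<gamma> (k + Suc i))) \<in> borel_measurable M"
    unfolding drift_eq
  proof (intro measurable_If borel_measurable_diff dual_measurable component_measurable t pos r)
    have "Measurable.pred M (\<lambda>\<gamma>. 1 \<le> snd (snd (?s \<gamma>)))"
      by measurable
    then have "Measurable.pred M ?c"
      using k by (intro pred_intros_logic(3) phase_length_measurable pred_intros_conj1') auto
    then show "{\<gamma> \<in> space M. ?c \<gamma>} \<in> sets M"
      by (simp only: pred_def)
  qed (use r s in measurable)
  show int: ?int
    using meas
  proof (rule integrable_bounded)
    fix \<gamma> assume \<gamma>: "\<gamma> \<in> space M"
    show "\<bar>drift \<phi> \<rho> T \<gamma> k i (\<gamma> (k + Suc i))\<bar> \<le> 3 + 2 * real T + real T * (\<rho> * real T)"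
    proof (cases "?c \<gamma>")
      case True
      interpret A: A_run "T - k" "?r \<gamma>" "delayed k \<gamma>"
        by unfold_locales
          (use k r0[OF True \<gamma>] component_truthful[OF \<gamma>] in \<open>auto simp: delayed_def\<close>)
      have "A.l i \<le> 1 + 2 * real i * (1 / sqrt (T - k))"
        using i by (intro A.l_le) simp
      also have "2 * real i * (1 / sqrt (T - k)) \<le> 2 * real T * 1"
        using i A.step_size by (intro mult_mono) auto
      finally have l: "fst (?s \<gamma>) \<le> 1 + 2 * real T"
        by (simp add: A.l_def)
      have "A.m i \<le> T"
        using A.m_le[of i] i by simp
      then have "fst (snd (?s \<gamma>)) * ?r \<gamma> \<le> T * (\<rho> * T)"
        using r0[OF True \<gamma>] pos[of \<gamma>] by (intro mult_mono) (auto simp: A.m_def)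
      moreover have "0 \<le> fst (snd (?s \<gamma>)) * ?r \<gamma>"
        using r0[OF True \<gamma>] pos[of \<gamma>] by simp
      moreover have "0 \<le> min 1 (?r \<gamma> / \<rho>) * \<phi>" "min 1 (?r \<gamma> / \<rho>) * \<phi> \<le> 1"
        using r0[OF True \<gamma>] \<phi> \<rho> by (auto intro!: mult_le_one)
      moreover have "drift \<phi> \<rho> T \<gamma> k i (\<gamma> (k + Suc i)) =
          dual (fst (?s \<gamma>)) (fst (snd (?s \<gamma>))) (?r \<gamma>) (\<gamma> (k + Suc i)) - min 1 (?r \<gamma> / \<rho>) * \<phi>"
        unfolding drift_eq if_P[OF True] ..
      ultimately show ?thesis
        using l dual_bounds[OF component_truthful[OF \<gamma> t] pos[of \<gamma>], of "?r \<gamma>"] by linarith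
    next
      case False
      have "drift \<phi> \<rho> T \<gamma> k i (\<gamma> (k + Suc i)) = 0"
        unfolding drift_eq if_not_P[OF False] ..
      then show ?thesis
        using \<rho> by simp
    qed
  qed
  have mean: "0 \<le> (LINT q|P. drift \<phi> \<rho> T \<gamma> k i q)" if \<gamma>: "\<gamma> \<in> space M" for \<gamma>
  proof (cases "?c \<gamma>")
    case True
    let ?l = "fst (?s \<gamma>)" and ?m = "fst (snd (?s \<gamma>))" and ?\<kappa> = "min 1 (?r \<gamma> / \<rho>)"
    have "?\<kappa> * \<phi> \<le> ?\<kappa> * (LINT q|P. dual ?l ?m \<rho> q)"
      using r0[OF True \<gamma>] \<rho> by (intro mult_left_mono dual pos) auto
    also have "\<dots> = (LINT q|P. ?\<kappa> * dual ?l ?m \<rho> q)"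
      by simp
    also have "\<dots> \<le> (LINT q|P. dual ?l ?m (?r \<gamma>) q)"
      by (intro integral_mono integrable_mult_right dual_integrable pos dual_scale_budget truthful
          r0[OF True \<gamma>] \<rho>)
    finally have "0 \<le> (LINT q|P. dual ?l ?m (?r \<gamma>) q) - ?\<kappa> * \<phi>"
      by simp
    also have "\<dots> = (LINT q|P. dual ?l ?m (?r \<gamma>) q - ?\<kappa> * \<phi>)"
      by (subst Bochner_Integration.integral_diff) (use dual_integrable[OF pos] req.prob_space in auto)
    also have "\<dots> = (LINT q|P. drift \<phi> \<rho> T \<gamma> k i q)"
      unfolding drift_eq if_P[OF True] ..
    finally show ?thesis .
  next
    case False
    have "drift \<phi> \<rho> T \<gamma> k i q = 0" for q
      unfolding drift_eq if_not_P[OF False] ..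
    then show ?thesis by simp
  qed
  show "0 \<le> (LINT \<gamma>|M. drift \<phi> \<rho> T \<gamma> k i (\<gamma> (k + Suc i)))"
    using t int by (rule predictable_integral_nonneg) (auto intro!: drift_cong mean)
qed


lemma
  fixes \<phi> :: real
  defines "\<phi> \<equiv> (LINT \<gamma>|completion M. opt_reward \<rho> T \<gamma>) / T"
  assumes int: "integrable (completion M) (opt_reward \<rho> T)"
  shows mean_opt_bounds: "0 \<le> \<phi>" "\<phi> \<le> 1"
    and mean_opt_le_dual: "l > 0 \<Longrightarrow> m \<ge> 0 \<Longrightarrow> \<phi> \<le> (LINT q|P. dual l m \<rho> q)"
proof -
  have tr: "\<gamma> t \<in> truthful_requests" if "\<gamma> \<in> space (completion M)" "t \<in> {1..T}" for \<gamma> t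
    using that by (auto intro: component_truthful)
  interpret C: prob_space "completion M"
    by (rule M.prob_space_completion)
  have "0 \<le> (LINT \<gamma>|completion M. opt_reward \<rho> T \<gamma>)"
    by (intro Bochner_Integration.integral_nonneg opt_reward_nonneg tr \<rho>)
  then show "0 \<le> \<phi>"
    by (simp add: \<phi>_def)
  have "(LINT \<gamma>|completion M. opt_reward \<rho> T \<gamma>) \<le> (LINT \<gamma>|completion M. real T)"
    by (intro integral_mono int opt_reward_le tr \<rho>) simp
  then show "\<phi> \<le> 1"
    using T C.prob_space by (simp add: \<phi>_def)
  assume lm: "l > 0" "m \<ge> 0"
  let ?D = "\<lambda>\<gamma>. \<Sum>t=1..T. dual l m \<rho> (\<gamma> t)"
  have dual_meas: "dual l m \<rho> \<in> borel_measurable P"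
    using dual_integrable[OF lm] by (rule borel_measurable_integrable)
  have D_int: "integrable M (\<lambda>\<gamma>. dual l m \<rho> (\<gamma> t))" if t: "t \<in> {1..T}" for t
  proof (rule integrable_bounded)
    show "(\<lambda>\<gamma>. dual l m \<rho> (\<gamma> t)) \<in> borel_measurable M"
      by (rule measurable_compose[OF component_measurable[OF t] dual_meas])
    show "\<bar>dual l m \<rho> (\<gamma> t)\<bar> \<le> 1 + l + \<bar>m * \<rho>\<bar>" if "\<gamma> \<in> space M" for \<gamma>
      using dual_bounds[OF component_truthful[OF that t] lm, of \<rho>] lm by auto
  qed
  have "integrable M ?D"
    by (intro Bochner_Integration.integrable_sum D_int)
  then have D: "integrable (completion M) ?D" "(LINT \<gamma>|completion M. ?D \<gamma>) = (LINT \<gamma>|M. ?D \<gamma>)"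
    by (auto simp: integrable_completion integral_completion borel_measurable_integrable)
  have "(LINT \<gamma>|completion M. opt_reward \<rho> T \<gamma>) \<le> (LINT \<gamma>|completion M. ?D \<gamma>)"
    by (intro integral_mono int D opt_reward_le_dual tr \<rho> lm)
  also have "\<dots> = (\<Sum>t=1..T. LINT \<gamma>|M. dual l m \<rho> (\<gamma> t))"
    unfolding D(2) by (intro Bochner_Integration.integral_sum D_int)
  also have "\<dots> = (\<Sum>t=1..T. LINT q|P. dual l m \<rho> q)"
    by (intro sum.cong component_integral dual_meas) auto
  also have "\<dots> = T * (LINT q|P. dual l m \<rho> q)"
    by simp
  finally show "\<phi> \<le> (LINT q|P. dual l m \<rho> q)"
    using T by (simp add: \<phi>_def field_simps)
qed

lemma regret_le:
  fixes \<beta> :: real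
  assumes \<beta>: "expected_truthful_gain P = \<beta>" "\<beta> > 0"
  shows "regret \<rho> T P (S_bids \<rho> T) \<le>
    (2 + 2 / \<rho>) * ((2 * sqrt T * ln T + 1) / \<beta>) + (8 + 2 / \<rho> + 2 / \<rho>\<^sup>2) * sqrt T"
    (is "_ \<le> ?bound")
proof -
  let ?rew = "\<lambda>\<gamma>. reward T \<gamma> (S_bids \<rho> T \<gamma>)"
  let ?Y = "\<lambda>\<gamma>. opt_reward \<rho> T \<gamma> - ?rew \<gamma>"
  show ?thesis
  proof (cases "integrable (completion M) ?Y")
    case False
    have "0 \<le> ?bound"
      using \<rho> \<beta> T by (intro add_nonneg_nonneg mult_nonneg_nonneg divide_nonneg_nonneg) auto
    then show ?thesis
      unfolding regret_def not_integrable_integral_eq[OF False] .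
  next
    case True
    have rew_int: "integrable M ?rew"
    proof (rule integrable_bounded[OF reward_S_measurable])
      fix \<gamma> assume \<gamma>: "\<gamma> \<in> space M"
      interpret S_run \<rho> T \<gamma>
        by (rule S_run[OF \<gamma>])
      show "\<bar>?rew \<gamma>\<bar> \<le> T"
        using reward_nonneg[OF truthful S_bids_nonneg] reward_le[OF truthful S_bids_nonneg]
        by (simp add: abs_le_iff)
    qed
    then have rew: "integrable (completion M) ?rew" "(LINT \<gamma>|completion M. ?rew \<gamma>) = (LINT \<gamma>|M. ?rew \<gamma>)"
      by (auto simp: integrable_completion integral_completion reward_S_measurable)
    have opt: "integrable (completion M) (opt_reward \<rho> T)"
      using Bochner_Integration.integrable_add[OF True rew(1)] by simp
    define \<phi> where "\<phi> = (LINT \<gamma>|completion M. opt_reward \<rho> T \<gamma>) / T"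
    have \<phi>: "0 \<le> \<phi>" "\<phi> \<le> 1" "\<And>l m. l > 0 \<Longrightarrow> m \<ge> 0 \<Longrightarrow> \<phi> \<le> (LINT q|P. dual l m \<rho> q)"
      using mean_opt_bounds[OF opt] mean_opt_le_dual[OF opt] by (auto simp: \<phi>_def)
    have "regret \<rho> T P (S_bids \<rho> T) = T * \<phi> - (LINT \<gamma>|M. ?rew \<gamma>)"
      unfolding regret_def using opt rew T by (simp add: \<phi>_def)
    also have "\<dots> = (LINT \<gamma>|M. T * \<phi> - ?rew \<gamma>)"
      using rew_int by (simp add: M.prob_space)
    finally have regret: "regret \<rho> T P (S_bids \<rho> T) = (LINT \<gamma>|M. T * \<phi> - ?rew \<gamma>)" .
    define W where "W \<gamma> = (\<Sum>i<T. first_drift \<beta> \<rho> T \<gamma> i (\<gamma> (Suc i)))" for \<gamma>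
    define X where "X \<gamma> = (\<Sum>k<T. \<Sum>i<T - k. drift \<phi> \<rho> T \<gamma> k i (\<gamma> (k + Suc i)))" for \<gamma>
    have W_int: "integrable M W"
      unfolding W_def by (intro Bochner_Integration.integrable_sum first_drift(1)[unfolded \<beta>]) auto
    have "(LINT \<gamma>|M. W \<gamma>) = (\<Sum>i<T. LINT \<gamma>|M. first_drift \<beta> \<rho> T \<gamma> i (\<gamma> (Suc i)))"
      unfolding W_def by (intro Bochner_Integration.integral_sum first_drift(1)[unfolded \<beta>]) auto
    also have "0 \<le> \<dots>"
      by (intro sum_nonneg first_drift(2)[unfolded \<beta>]) auto
    finally have W: "0 \<le> (LINT \<gamma>|M. W \<gamma>)" .
    have drift_int: "integrable M (\<lambda>\<gamma>. drift \<phi> \<rho> T \<gamma> k i (\<gamma> (k + Suc i)))"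
      if "k \<in> {..<T}" "i \<in> {..<T - k}" for k i
      using that by (intro drift(1) \<phi>) auto
    have X_int: "integrable M X"
      unfolding X_def by (intro Bochner_Integration.integrable_sum drift_int)
    have "(LINT \<gamma>|M. X \<gamma>) = (\<Sum>k<T. LINT \<gamma>|M. (\<Sum>i<T - k. drift \<phi> \<rho> T \<gamma> k i (\<gamma> (k + Suc i))))"
      unfolding X_def
      by (intro Bochner_Integration.integral_sum Bochner_Integration.integrable_sum drift_int)
    also have "\<dots> = (\<Sum>k<T. \<Sum>i<T - k. LINT \<gamma>|M. drift \<phi> \<rho> T \<gamma> k i (\<gamma> (k + Suc i)))"
      by (intro sum.cong refl Bochner_Integration.integral_sum drift_int)
    also have "0 \<le> \<dots>"
      by (intro sum_nonneg drift(2) \<phi>) auto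
    finally have X: "0 \<le> (LINT \<gamma>|M. X \<gamma>)" .
    let ?c = "(2 + 2 / \<rho>) / \<beta>"
    have c: "0 \<le> ?c"
      using \<rho> \<beta> by simp
    have pathwise: "T * \<phi> - ?rew \<gamma> \<le> ?bound - ?c * W \<gamma> - X \<gamma>" if \<gamma>: "\<gamma> \<in> space M" for \<gamma>
    proof -
      interpret S_run \<rho> T \<gamma>
        by (rule S_run[OF \<gamma>])
      have "\<beta> * K \<le> 2 * sqrt T * ln T + 1 - W \<gamma>"
        using first_phase_length_bound[of \<beta>] by (simp add: W_def)
      then have "?c * (\<beta> * K) \<le> ?c * (2 * sqrt T * ln T + 1 - W \<gamma>)"
        using c by (rule mult_left_mono)
      moreover have "?c * (\<beta> * K) = (2 + 2 / \<rho>) * K"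
        using \<beta> by simp
      moreover have "?c * (2 * sqrt T * ln T + 1 - W \<gamma>) =
          (2 + 2 / \<rho>) * ((2 * sqrt T * ln T + 1) / \<beta>) - ?c * W \<gamma>"
        by (simp add: right_diff_distrib)
      ultimately show ?thesis
        using regret_pathwise[OF \<phi>(1,2)] unfolding X_def by linarith
    qed
    have "(LINT \<gamma>|M. T * \<phi> - ?rew \<gamma>) \<le> (LINT \<gamma>|M. ?bound - ?c * W \<gamma> - X \<gamma>)"
      using rew_int W_int X_int pathwise by (intro integral_mono) auto
    also have "\<dots> = (LINT \<gamma>|M. ?bound - ?c * W \<gamma>) - (LINT \<gamma>|M. X \<gamma>)"
      using W_int X_int by (intro Bochner_Integration.integral_diff) auto
    also have "(LINT \<gamma>|M. ?bound - ?c * W \<gamma>) = ?bound - ?c * (LINT \<gamma>|M. W \<gamma>)"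
      using W_int by (subst Bochner_Integration.integral_diff) (auto simp: M.prob_space)
    finally show ?thesis
      using regret X mult_nonneg_nonneg[OF c W] by linarith
  qed
qed

end

theorem theorem5p2:
  fixes \<rho> \<beta> :: real
  assumes "\<rho> > 0" and "\<beta> > 0"
  shows "(\<exists>C. \<forall>P T. request_distribution P \<and> expected_truthful_gain P = \<beta> \<and> T \<ge> 2 \<longrightarrow>
             regret \<rho> T P (S_bids \<rho> T) \<le> C * (sqrt (real T) * ln (real T)))
       \<and> (\<forall>P T. request_distribution P \<and> expected_truthful_gain P = \<beta> \<and> T \<ge> 1 \<longrightarrow>
             (\<forall>\<gamma>\<in>space (iid_requests T P).
                satisfies_RoS T \<gamma> (S_bids \<rho> T \<gamma>) \<and>
                (\<rho> * real T \<ge> 1 \<longrightarrow> satisfies_budget \<rho> T \<gamma> (S_bids \<rho> T \<gamma>))))"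
proof -
  let ?C = "(2 + 2 / \<rho>) * (4 / \<beta>) + (8 + 2 / \<rho> + 2 / \<rho>\<^sup>2) * 2"
  have "regret \<rho> T P (S_bids \<rho> T) \<le> ?C * (sqrt (real T) * ln (real T))"
    if P: "request_distribution P" "expected_truthful_gain P = \<beta>" and T2: "T \<ge> 2" for P T
  proof -
    interpret iid P T \<rho>
      by unfold_locales (use P T2 assms in auto)
    let ?L = "sqrt (real T) * ln (real T)"
    have "ln 2 \<le> ln (real T)"
      using T2 by (intro ln_mono) auto
    then have "1 / 2 \<le> ln (real T)"
      using ln2_ge_two_thirds by simp
    then have "sqrt (real T) * (1 / 2) \<le> ?L"
      by (intro mult_left_mono) auto
    then have sq: "sqrt (real T) \<le> 2 * ?L"
      by simp
    have "1 \<le> sqrt (real T)"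
      using T2 by simp
    with sq have "2 * sqrt (real T) * ln (real T) + 1 \<le> 4 * ?L"
      by linarith
    then have "(2 + 2 / \<rho>) * ((2 * sqrt (real T) * ln (real T) + 1) / \<beta>) \<le> (2 + 2 / \<rho>) * (4 * ?L / \<beta>)"
      using assms by (intro mult_left_mono divide_right_mono) auto
    moreover have "(8 + 2 / \<rho> + 2 / \<rho>\<^sup>2) * sqrt (real T) \<le> (8 + 2 / \<rho> + 2 / \<rho>\<^sup>2) * (2 * ?L)"
      using assms sq by (intro mult_left_mono) auto
    moreover have "(2 + 2 / \<rho>) * (4 * ?L / \<beta>) + (8 + 2 / \<rho> + 2 / \<rho>\<^sup>2) * (2 * ?L) = ?C * ?L"
      by (simp only: distrib_right times_divide_eq_left mult.assoc)
    ultimately show ?thesis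
      using regret_le[OF P(2) assms(2)] by linarith
  qed
  moreover have "satisfies_RoS T \<gamma> (S_bids \<rho> T \<gamma>) \<and>
      (\<rho> * real T \<ge> 1 \<longrightarrow> satisfies_budget \<rho> T \<gamma> (S_bids \<rho> T \<gamma>))"
    if "request_distribution P" "T \<ge> 1" "\<gamma> \<in> space (iid_requests T P)" for P T \<gamma>
  proof -
    interpret iid P T \<rho>
      by unfold_locales (use that assms in auto)
    interpret S_run \<rho> T \<gamma>
      using that by (intro S_run)
    show ?thesis
      using RoS budget by blast
  qed
  ultimately show ?thesis
    by blast
qed

end
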